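(* Let $\sigma\in(0,1)$ and, for $\tau$ in the open arc $(\tau_\sigma^-,\tau_\sigma^+)$ of $\mathbb{T}$, let $B_\tau=B_{m_{\sigma,\tau}}$ be the corresponding purely balanced geodesic through the point $(0,-\sigma^2)$. Then $T_{(0,-\sigma^2)}B_\tau=\sharp_{(0,-\sigma^2)}$ if and only if $\tau=1$.
   Context: $\mathbb{D}$ is the open unit disc and $\mathbb{T}$ the unit circle in $\mathbb{C}$. $G=\{(z+w,zw): |z|<1,|w|<1\}\subset\mathbb{C}^2$ is the symmetrized bidisc, and $\mathcal{R}=\{(2z,z^2):z\in\mathbb{D}\}$ is the royal variety. For $\sigma\in(0,1)$, let $\tau_\sigma^+$ (respectively $\tau_\sigma^-$) be the unique point $\tau\in\mathbb{T}$ with $\left|\frac{\tau-1}{\tau+1}\right|=\frac{2\sigma}{1-\sigma^2}$ and $\mathrm{Im}\,\tau>0$ (respectively $\mathrm{Im}\,\tau<0$); $(\tau_\sigma^-,\tau_\sigma^+)$ is the open arc of $\mathbb{T}$ traversed counterclockwise from $\tau_\sigma^-$ to $\tau_\sigma^+$ (it contains $1$). Let $b_\sigma(z)=\frac{z-\sigma}{1-\sigma z}$, $r_\tau(z)=\tau z$ and $m_{\sigma,\tau}=b_\sigma\circ r_\tau\circ b_\sigma\in\mathrm{Aut}\,\mathbb{D}$. For $m\in\mathrm{Aut}\,\mathbb{D}$ put $h_m(z)=(z+m(z),zm(z))$ and $B_m=h_m(\mathbb{D})\subset G$. For $\tau\in(\tau_\sigma^-,\tau_\sigma^+)$, $B_\tau$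 is a complex geodesic (a set $h(\mathbb{D})$ with $h:\mathbb{D}\to G$ holomorphic having a holomorphic left inverse), and it passes through $(0,-\sigma^2)$, since $m_{\sigma,\tau}(\sigma)=-\sigma$. If $D=h(\mathbb{D})$ is a geodesic and $\lambda=h(z)$, then $T_\lambda D=\mathbb{C}\,h'(z)$. A geodesic $D$ is purely balanced if $D^-\cap\mathcal{R}^-$ consists of exactly two points, both lying in $\{(2z,z^2):z\in\mathbb{T}\}$. Sharp direction: let $\mathrm{Orb}(\lambda)$ be the orbit of $\lambda\in G$ under the group $\mathrm{Aut}\,G$ of biholomorphic self-maps of $G$. It is known that $\mathrm{Orb}(\lambda)=\mathcal{R}$ if $\lambda\in\mathcal{R}$, and $\mathrm{Orb}(\lambda)$ is a smooth properly embedded real 3-dimensional submanifold of $G$ if $\lambda\notin\mathcal{R}$. In both cases the real tangent space to $\mathrm{Orb}(\lambda)$ at $\lambda$ contains a unique one-dimensional complex subspace of $\mathbb{C}^2$, denoted $\sharp_\lambda$. *)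

theory Defs
  imports "HOL-Complex_Analysis.Complex_Analysis"
begin

abbreviation unit_disc :: "complex set" ("\<bbbD>")
  where "\<bbbD> \<equiv> ball 0 1"

abbreviation unit_circle :: "complex set" ("\<bbbT>")
  where "\<bbbT> \<equiv> sphere 0 1"

text \<open>The complex vector space structure of \<open>\<complex>\<^sup>2\<close> is the one on \<^typ>\<open>complex^2\<close> given by
  \<open>c *s v\<close>, with its library notions \<open>vec.subspace\<close>, \<open>vec.span\<close> and \<open>vec.dim\<close>.\<close>

text \<open>Complex (Frechet) differentiability at every point; meant for open \<open>U\<close>.\<close>

definition holomorphic_fun_on :: "(complex^'n \<Rightarrow> complex) \<Rightarrow> (complex^'n) set \<Rightarrow> bool"
  where "holomorphic_fun_on f U \<longleftrightarrow>
    (\<forall>x\<in>U. \<exists>f'. (f has_derivative f') (at x) \<and> (\<forall>c v. f' (c *s v) = c * f' v))"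

definition holomorphic_map_on :: "(complex^'n \<Rightarrow> complex^'m) \<Rightarrow> (complex^'n) set \<Rightarrow> bool"
  where "holomorphic_map_on F U \<longleftrightarrow> (\<forall>i. holomorphic_fun_on (\<lambda>x. F x $ i) U)"

text \<open>The biholomorphic self-maps of \<open>U\<close>; the values of \<open>F\<close> outside \<open>U\<close> are irrelevant.\<close>

definition Aut :: "(complex^'n) set \<Rightarrow> (complex^'n \<Rightarrow> complex^'n) set"
  where "Aut U = {F. bij_betw F U U \<and> holomorphic_map_on F U \<and>
                     holomorphic_map_on (the_inv_into U F) U}"

definition curve_deriv :: "(complex \<Rightarrow> complex^'n) \<Rightarrow> complex \<Rightarrow> complex^'n"
  where "curve_deriv h z = (\<chi> i. deriv (\<lambda>\<zeta>. h \<zeta> $ i) z)"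

definition sym_bidisc :: "(complex^2) set"
  where "sym_bidisc = {vector [z + w, z * w] | z w. z \<in> \<bbbD> \<and> w \<in> \<bbbD>}"

definition royal :: "(complex^2) set"
  where "royal = {vector [2 * z, z\<^sup>2] | z. z \<in> \<bbbD>}"

definition geodesic_map :: "(complex \<Rightarrow> complex^2) \<Rightarrow> bool"
  where "geodesic_map h \<longleftrightarrow>
    (\<forall>i. (\<lambda>z. h z $ i) holomorphic_on \<bbbD>) \<and> h ` \<bbbD> \<subseteq> sym_bidisc \<and>
    (\<exists>g. holomorphic_fun_on g sym_bidisc \<and> g ` sym_bidisc \<subseteq> \<bbbD> \<and> (\<forall>z\<in>\<bbbD>. g (h z) = z))"

definition geodesic :: "(complex^2) set \<Rightarrow> bool"
  where "geodesic D \<longleftrightarrow> (\<exists>h. geodesic_map h \<and> D = h ` \<bbbD>)"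

definition purely_balanced :: "(complex^2) set \<Rightarrow> bool"
  where "purely_balanced D \<longleftrightarrow> geodesic D \<and>
    card (closure D \<inter> closure royal) = 2 \<and>
    closure D \<inter> closure royal \<subseteq> {vector [2 * z, z\<^sup>2] | z. z \<in> \<bbbT>}"

text \<open>The tangent space of a geodesic \<open>D\<close> at \<open>p \<in> D\<close>, the complex line spanned by \<open>h' z\<close>.
  It does not depend on the parametrization \<open>h\<close>: two of them differ by a holomorphic change of variable on the disc.\<close>

definition geodesic_tangent :: "(complex^2) set \<Rightarrow> complex^2 \<Rightarrow> (complex^2) set"
  where "geodesic_tangent D p = (THE V. \<exists>h z. geodesic_map h \<and> D = h ` \<bbbD> \<and>
           z \<in> \<bbbD> \<and> p = h z \<and> V = vec.span {curve_deriv h z})"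

definition Orb :: "complex^2 \<Rightarrow> (complex^2) set"
  where "Orb p = {F p | F. F \<in> Aut sym_bidisc}"

text \<open>The real tangent space at \<open>x\<close> of an embedded submanifold \<open>M\<close>: the velocities of
  \<open>C\<^sup>1\<close> curves in \<open>M\<close> through \<open>x\<close>.\<close>

definition real_tangent_space :: "'a::real_normed_vector set \<Rightarrow> 'a \<Rightarrow> 'a set"
  where "real_tangent_space M x = {v. \<exists>\<gamma> e. 0 < e \<and> \<gamma> C1_differentiable_on {-e<..<e} \<and>
           \<gamma> ` {-e<..<e} \<subseteq> M \<and> \<gamma> 0 = x \<and> (\<gamma> has_vector_derivative v) (at 0)}"

definition sharp :: "complex^2 \<Rightarrow> (complex^2) set"
  where "sharp p = (THE V. vec.subspace V \<and> vec.dim V = 1 \<and> V \<subseteq> real_tangent_space (Orb p) p)"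

definition tau_plus :: "real \<Rightarrow> complex"
  where "tau_plus \<sigma> = (THE \<tau>. \<tau> \<in> \<bbbT> \<and>
           cmod ((\<tau> - 1) / (\<tau> + 1)) = 2 * \<sigma> / (1 - \<sigma>\<^sup>2) \<and> Im \<tau> > 0)"

definition tau_minus :: "real \<Rightarrow> complex"
  where "tau_minus \<sigma> = (THE \<tau>. \<tau> \<in> \<bbbT> \<and>
           cmod ((\<tau> - 1) / (\<tau> + 1)) = 2 * \<sigma> / (1 - \<sigma>\<^sup>2) \<and> Im \<tau> < 0)"

text \<open>The open arc of the circle run through counterclockwise from \<open>a\<close> to \<open>b\<close>.\<close>

definition open_arc :: "complex \<Rightarrow> complex \<Rightarrow> complex set"
  where "open_arc a b = {a * cis t | t. 0 < t \<and> t < Arg2pi (b / a)}"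

definition b_map :: "real \<Rightarrow> complex \<Rightarrow> complex"
  where "b_map \<sigma> z = (z - of_real \<sigma>) / (1 - of_real \<sigma> * z)"

definition r_map :: "complex \<Rightarrow> complex \<Rightarrow> complex"
  where "r_map \<tau> z = \<tau> * z"

definition m_map :: "real \<Rightarrow> complex \<Rightarrow> complex \<Rightarrow> complex"
  where "m_map \<sigma> \<tau> = b_map \<sigma> \<circ> r_map \<tau> \<circ> b_map \<sigma>"

definition h_map :: "(complex \<Rightarrow> complex) \<Rightarrow> complex \<Rightarrow> complex^2"
  where "h_map m z = vector [z + m z, z * m z]"

definition B_set :: "(complex \<Rightarrow> complex) \<Rightarrow> (complex^2) set"
  where "B_set m = h_map m ` \<bbbD>"

definition base_point :: "real \<Rightarrow> complex^2"
  where "base_point \<sigma> = vector [0, - (of_real \<sigma>)\<^sup>2]"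

end

theory Submission
  imports Defs
begin

text \<open>The computation behind the theorem is short. Since \<open>m_map \<sigma> \<tau>\<close> sends \<open>\<sigma>\<close> to \<open>- \<sigma>\<close> with derivative
  \<open>\<tau>\<close> there, the tangent of \<open>B_set (m_map \<sigma> \<tau>)\<close> at the base point is spanned by
  \<open>(1 + \<tau>, \<sigma> (\<tau> - 1))\<close>. The sharp direction at the base point is the horizontal line, spanned by
  \<open>(1, 0)\<close> (\<open>sharp_base_point\<close>). The two lines agree exactly for \<open>\<tau> = 1\<close>. The work is in identifying the
  sharp direction, in showing that the two lines are well defined, and in the geometry of the geodesics.

  Sharp direction. The base point is \<open>(z + w, z w)\<close> with \<open>z = \<sigma>\<close>, \<open>w = - \<sigma>\<close>. Moving \<open>z\<close> and \<open>w\<close> by the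
  same Moebius map is an automorphism of the symmetrized bidisc, which gives enough curves in the orbit to
  realize every horizontal vector as a velocity. Conversely every automorphism has this form, so
  it preserves the pseudohyperbolic distance of \<open>z\<close> and \<open>w\<close>. The orbit therefore lies in an explicit real
  hypersurface, whose tangent vectors \<open>v\<close> at the base point satisfy \<open>Re v\<^sub>2 = 0\<close>, and the only complex line
  in that real hyperplane is the horizontal one.

  Automorphisms. The description of the automorphisms is the main step. It follows the pattern of the
  Remmert--Stein argument for the bidisc. Call the image of the disc under \<open>z \<mapsto> (z + w, z w)\<close> a leaf; through
  a point off the royal variety pass two leaves, and their tangents are the null directions of the
  quadratic form \<open>v\<^sub>2\<^sup>2 - s v\<^sub>1 v\<^sub>2 + p v\<^sub>1\<^sup>2\<close> (\<open>leaf_form\<close>). For a leaf pushed forward by an automorphism, the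
  value of this form times the discriminant \<open>s\<^sup>2 - 4 p\<close> depends holomorphically on the parameter \<open>w\<close> and
  tends to 0 as \<open>w\<close> tends to the circle, because an automorphism is proper and a disc close to the boundary of
  the domain is nearly null (\<open>leaf_form_boundary_estimate\<close>). By the maximum principle the product vanishes;
  the discriminant does not vanish identically, so the form vanishes and automorphisms preserve null directions. Two distinct null directions exist exactly off the royal variety, so
  this variety is preserved as well, and then a leaf must go to the leaf through the image of its point on the
  royal variety (\<open>leaf_in_leaf\<close>). As a point is the intersection of its two leaves, the automorphism is determined by its
  action on the royal variety, which is a disc (\<open>automorphism_symmetrize\<close>).

  Geodesics. For \<open>\<tau>\<close> in the arc, \<open>m_map \<sigma> \<tau>\<close> is hyperbolic, with two fixed points \<open>\<eta>\<close> and
  \<open>- cnj \<eta>\<close> on the circle; these give the two points of the closure on the royal boundary. After a Cayley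
  transform that sends \<open>\<eta>\<close> to infinity, \<open>m_map \<sigma> \<tau>\<close> becomes an affine map of the right half plane. The sum of the
  Cayley transforms of \<open>z\<close> and \<open>w\<close> is a holomorphic function of \<open>(z + w, z w)\<close>, and on the geodesic it is an affine function of the
  Cayley transform of \<open>z\<close>; solving for \<open>z\<close> is the left inverse (\<open>geodesic_map_of_affine_cayley\<close>).\<close>

section \<open>The Schwarz--Pick lemma\<close>

text \<open>Conjugation with Moebius maps brings \<open>g\<close> to a map that fixes 0, the situation of the Schwarz lemma.\<close>

lemma schwarz_pick_conjugate:
  assumes g: "g holomorphic_on \<bbbD>" "g ` \<bbbD> \<subseteq> \<bbbD>" and w: "w \<in> \<bbbD>"
  defines "\<phi> \<equiv> Moebius_function 0 (g w) \<circ> g \<circ> Moebius_function 0 (- w)"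
  shows "\<phi> holomorphic_on \<bbbD>" "\<phi> 0 = 0" "\<And>z. norm z < 1 \<Longrightarrow> norm (\<phi> z) < 1"
proof -
  have gw: "norm (g w) < 1" using g(2) w by (metis image_subset_iff mem_ball_0)
  have M: "Moebius_function 0 (- w) ` \<bbbD> \<subseteq> \<bbbD>"
    using w by (auto intro!: Moebius_function_norm_lt_1)
  have "Moebius_function 0 (g w) \<circ> g holomorphic_on \<bbbD>"
    by (rule holomorphic_on_compose_gen[OF g(1) Moebius_function_holomorphic g(2)]) (use gw in auto)
  then show "\<phi> holomorphic_on \<bbbD>"
    unfolding \<phi>_def
    by (rule holomorphic_on_compose_gen[rotated, OF _ M]) (use w in \<open>auto intro: Moebius_function_holomorphic\<close>)
  show "\<phi> 0 = 0"
    by (simp add: \<phi>_def Moebius_function_def)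
  show "norm (\<phi> z) < 1" if "norm z < 1" for z
  proof -
    have "Moebius_function 0 (- w) z \<in> \<bbbD>" using M that by (simp add: image_subset_iff)
    then have "norm (g (Moebius_function 0 (- w) z)) < 1"
      using g(2) by (metis image_subset_iff mem_ball_0)
    then show ?thesis by (simp add: \<phi>_def Moebius_function_norm_lt_1 gw)
  qed
qed

lemma schwarz_pick:
  assumes g: "g holomorphic_on \<bbbD>" "g ` \<bbbD> \<subseteq> \<bbbD>" and w: "w \<in> \<bbbD>" and z: "z \<in> \<bbbD>"
  shows "norm (Moebius_function 0 (g w) (g z)) \<le> norm (Moebius_function 0 w z)"
proof -
  have n: "norm (Moebius_function 0 w z) < 1"
    using w z by (auto intro!: Moebius_function_norm_lt_1)
  have "Moebius_function 0 (- w) (Moebius_function 0 w z) = z"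
    using w z by (intro Moebius_function_compose) auto
  with Schwarz_Lemma(1)[OF schwarz_pick_conjugate[OF g w] n] show ?thesis
    by simp
qed

lemma schwarz_pick_deriv:
  assumes g: "g holomorphic_on \<bbbD>" "g ` \<bbbD> \<subseteq> \<bbbD>" and w: "w \<in> \<bbbD>"
  shows "norm (deriv g w) * (1 - (norm w)\<^sup>2) \<le> 1 - (norm (g w))\<^sup>2"
proof -
  have gw: "norm (g w) < 1" using g(2) w by (metis image_subset_iff mem_ball_0)
  have nw: "norm w < 1" using w by simp
  have p1: "(norm w)\<^sup>2 < 1" "(norm (g w))\<^sup>2 < 1"
    using nw gw by (simp_all add: power_less_one_iff abs_square_less_1)
  have n1: "1 - cnj (g w) * g w = of_real (1 - (norm (g w))\<^sup>2)"
    by (metis complex_norm_square mult.commute of_real_1 of_real_diff of_real_power)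
  have n2: "1 - cnj w * w = of_real (1 - (norm w)\<^sup>2)"
    by (metis complex_norm_square mult.commute of_real_1 of_real_diff of_real_power)
  have d1: "(Moebius_function 0 (- w) has_field_derivative 1 - cnj w * w) (at 0)"
    unfolding Moebius_function_simple[abs_def]
    by (rule derivative_eq_intros refl | simp)+
  have d2: "(g has_field_derivative deriv g w) (at (Moebius_function 0 (- w) 0))"
    using holomorphic_derivI[OF g(1) _ w] by (simp add: Moebius_function_def)
  have nz: "1 - cnj (g w) * g w \<noteq> 0"
    using p1(2) unfolding n1 by (simp del: of_real_diff)
  have d3: "(Moebius_function 0 (g w) has_field_derivative 1 / (1 - cnj (g w) * g w)) (at ((g \<circ> Moebius_function 0 (- w)) 0))"
    unfolding Moebius_function_simple[abs_def]
    using nz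
    by (auto intro!: derivative_eq_intros simp: divide_simps)
  have "(Moebius_function 0 (g w) \<circ> g \<circ> Moebius_function 0 (- w)
     has_field_derivative 1 / (1 - cnj (g w) * g w) * (deriv g w * (1 - cnj w * w))) (at 0)"
    using DERIV_chain[OF d3 DERIV_chain[OF d2 d1]] by (simp add: o_assoc)
  then have "norm (1 / (1 - cnj (g w) * g w) * (deriv g w * (1 - cnj w * w))) \<le> 1"
    using Schwarz_Lemma(2)[OF schwarz_pick_conjugate[OF g w], of 0] by (simp only: DERIV_imp_deriv norm_zero zero_less_one)
  then show ?thesis
    using p1 unfolding n1 n2 norm_mult norm_divide norm_of_real
    by (simp add: divide_simps split: if_splits)
qed

section \<open>Holomorphic dependence of a derivative on a parameter\<close>

text \<open>Schwarz--Pick bounds the difference quotients in \<open>z\<close> uniformly in \<open>w\<close>, so Montel's theorem upgrades their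
  pointwise convergence to convergence towards a holomorphic function of \<open>w\<close>.\<close>

lemma deriv_holomorphic_in_parameter:
  assumes fz: "\<And>w. w \<in> \<bbbD> \<Longrightarrow> (\<lambda>z. f z w) holomorphic_on \<bbbD>"
    and fw: "\<And>z. z \<in> \<bbbD> \<Longrightarrow> (\<lambda>w. f z w) holomorphic_on \<bbbD>"
    and bound: "\<And>z w. z \<in> \<bbbD> \<Longrightarrow> w \<in> \<bbbD> \<Longrightarrow> f z w \<in> \<bbbD>"
    and a: "a \<in> \<bbbD>"
  shows "(\<lambda>w. deriv (\<lambda>z. f z w) a) holomorphic_on \<bbbD>"
proof -
  define h where "h n = complex_of_real ((1 - norm a) / 2 / Suc n)" for n
  have a1: "norm a < 1" using a by simp
  have h0: "h n \<noteq> 0" for n using a1 by (simp add: h_def del: of_nat_Suc)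
  have hlim: "h \<longlonglongrightarrow> 0"
    unfolding h_def
    by (rule tendsto_of_real[where a=0, unfolded of_real_0]) (rule LIMSEQ_Suc[OF lim_const_over_n])
  have hn: "norm (h n) < 1 - norm a" for n
  proof -
    have "(1 - norm a) / 2 / real (Suc n) \<le> (1 - norm a) / 2"
      using a1 divide_left_mono[of 1 "real (Suc n)" "(1 - norm a) / 2"] by simp
    also have "\<dots> < 1 - norm a" using a1 by simp
    finally show ?thesis using a1 unfolding h_def norm_of_real by (simp del: of_nat_Suc)
  qed
  have ah: "a + h n \<in> \<bbbD>" for n
    using norm_triangle_ineq[of a "h n"] hn[of n] by simp
  define q where "q n w = (f (a + h n) w - f a w) / h n" for n w
  have qhol: "q n holomorphic_on \<bbbD>" for n
    unfolding q_def by (intro holomorphic_intros fw ah a h0)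
  have qlim: "(\<lambda>n. q n w) \<longlonglongrightarrow> deriv (\<lambda>z. f z w) a" if w: "w \<in> \<bbbD>" for w
  proof -
    have "((\<lambda>z. f z w) has_field_derivative deriv (\<lambda>z. f z w) a) (at a)"
      by (rule holomorphic_derivI[OF fz[OF w] _ a]) simp
    then have "((\<lambda>k. (f (a + k) w - f a w) / k) \<longlongrightarrow> deriv (\<lambda>z. f z w) a) (at 0)"
      by (simp add: DERIV_def)
    moreover have "filterlim h (at 0) sequentially"
      using hlim h0 by (simp add: filterlim_at)
    ultimately show ?thesis
      unfolding q_def by (rule filterlim_compose)
  qed
  have qb: "norm (q n w) \<le> 2 / (1 - norm a)" if w: "w \<in> \<bbbD>" for n w
  proof -
    let ?u = "f a w" and ?v = "f (a + h n) w"
    have u: "norm ?u < 1" "norm ?v < 1" using bound[OF a w] bound[OF ah w] by auto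
    have "(\<lambda>z. f z w) ` \<bbbD> \<subseteq> \<bbbD>" using bound w by auto
    from schwarz_pick[OF fz[OF w] this a ah]
    have sp: "norm ((?v - ?u) / (1 - cnj ?u * ?v)) \<le> norm (h n / (1 - cnj a * (a + h n)))"
      by (simp add: Moebius_function_simple)
    have prod: "norm (cnj ?u * ?v) < 1" "norm (cnj a * (a + h n)) < 1"
        "norm (cnj a * (a + h n)) \<le> norm a"
      using u a1 ah[of n] mult_strict_mono[of "norm ?u" 1 "norm ?v" 1]
        mult_left_mono[of "norm (a + h n)" 1 "norm a"]
      by (auto simp: norm_mult)
    have l: "norm (1 - cnj ?u * ?v) \<le> 2"
      using norm_triangle_ineq4[of 1 "cnj ?u * ?v"] prod by simp
    have nz: "norm (1 - cnj ?u * ?v) > 0" using prod(1) by auto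
    have r: "norm (1 - cnj a * (a + h n)) \<ge> 1 - norm a"
      using norm_triangle_ineq2[of 1 "cnj a * (a + h n)"] prod by simp
    have "norm (?v - ?u) \<le> norm (1 - cnj ?u * ?v) * norm (h n / (1 - cnj a * (a + h n)))"
      using sp nz by (simp add: norm_divide pos_divide_le_eq mult.commute)
    also have "\<dots> \<le> 2 * (norm (h n) / (1 - norm a))"
      using l r a1 by (intro mult_mono) (auto simp: norm_divide intro!: divide_left_mono mult_pos_pos)
    finally show ?thesis
      using h0[of n] a1 by (simp add: q_def norm_divide pos_divide_le_eq pos_le_divide_eq mult_ac)
  qed
  obtain g r where g: "g holomorphic_on \<bbbD>" and r: "strict_mono (r :: nat \<Rightarrow> nat)"
    and gl: "\<And>x. x \<in> \<bbbD> \<Longrightarrow> (\<lambda>n. q (r n) x) \<longlonglongrightarrow> g x"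
  proof (rule Montel[of \<bbbD> "range q" q])
    show "\<exists>B. \<forall>h\<in>range q. \<forall>z\<in>K. norm (h z) \<le> B" if "compact K" "K \<subseteq> \<bbbD>" for K
      using qb that by blast
  qed (use qhol in auto)
  have "deriv (\<lambda>z. f z w) a = g w" if w: "w \<in> \<bbbD>" for w
    using LIMSEQ_unique[OF LIMSEQ_subseq_LIMSEQ[OF qlim[OF w] r] ] gl[OF w] by (simp add: o_def)
  then show ?thesis
    using holomorphic_transform[OF g] by metis
qed

section \<open>Holomorphic functions of several variables along curves\<close>

text \<open>Differentials of maps on \<open>\<complex>\<^sup>n\<close> enter only through the chain rule along holomorphic curves.\<close>

definition has_curve_derivative :: "(complex \<Rightarrow> complex^'n) \<Rightarrow> complex^'n \<Rightarrow> complex \<Rightarrow> bool"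
  where "has_curve_derivative h v z \<longleftrightarrow> (\<forall>i. ((\<lambda>\<zeta>. h \<zeta> $ i) has_field_derivative v $ i) (at z))"

lemma has_curve_derivative_nth:
  "has_curve_derivative h v z \<Longrightarrow> ((\<lambda>\<zeta>. h \<zeta> $ i) has_field_derivative v $ i) (at z)"
  by (simp add: has_curve_derivative_def)

lemma has_curve_derivative_imp_curve_deriv: "has_curve_derivative h v z \<Longrightarrow> curve_deriv h z = v"
  by (simp add: has_curve_derivative_def curve_deriv_def vec_eq_iff DERIV_imp_deriv)

lemma has_curve_derivative_curve_deriv:
  fixes h :: "complex \<Rightarrow> complex^'n"
  assumes "\<And>i. (\<lambda>z. h z $ i) holomorphic_on S" "open S" "z \<in> S"
  shows "has_curve_derivative h (curve_deriv h z) z"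
  using holomorphic_derivI[OF assms] by (simp add: has_curve_derivative_def curve_deriv_def)

lemma has_curve_derivative_imp_has_derivative:
  assumes "has_curve_derivative h v z"
  shows "(h has_derivative (\<lambda>c. c *s v)) (at z)"
proof -
  have "((\<lambda>\<zeta>. \<Sum>i\<in>UNIV. axis i (h \<zeta> $ i)) has_derivative (\<lambda>c. \<Sum>i\<in>UNIV. axis i (v $ i * c))) (at z)"
    by (intro has_derivative_sum bounded_linear.has_derivative[of "axis _"]
          has_curve_derivative_nth[OF assms, unfolded has_field_derivative_def])
       (auto intro!: bounded_linearI' simp: axis_def vec_eq_iff)
  moreover have "(\<Sum>i\<in>UNIV. axis i (x $ i)) = x" for x :: "complex^'a"
    by (simp add: vec_eq_iff axis_def)
  moreover have "(\<Sum>i\<in>UNIV. axis i (v $ i * c)) = c *s v" for c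
    by (simp add: vec_eq_iff axis_def mult.commute)
  ultimately show ?thesis by simp
qed

lemma has_derivative_along_curve:
  fixes f :: "complex^'n \<Rightarrow> complex"
  assumes "(f has_derivative f') (at (h z))" "\<And>c v. f' (c *s v) = c * f' v" "has_curve_derivative h v z"
  shows "((\<lambda>\<zeta>. f (h \<zeta>)) has_field_derivative f' v) (at z)"
proof -
  have "((\<lambda>\<zeta>. f (h \<zeta>)) has_derivative (\<lambda>c. f' (c *s v))) (at z)"
    using has_derivative_compose[OF has_curve_derivative_imp_has_derivative[OF assms(3)]] assms(1)
    by fastforce
  then show ?thesis
    by (simp add: has_field_derivative_def assms(2) mult.commute[of _ "f' v"])
qed

lemma holomorphic_fun_on_along_curve:
  fixes f :: "complex^'n \<Rightarrow> complex"
  assumes "holomorphic_fun_on f U" "h z \<in> U" "has_curve_derivative h v z"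
  shows "\<exists>c. ((\<lambda>\<zeta>. f (h \<zeta>)) has_field_derivative c) (at z)"
  using assms has_derivative_along_curve[of f _ h z v] unfolding holomorphic_fun_on_def by meson

definition complex_linear :: "(complex^'n \<Rightarrow> complex^'m) \<Rightarrow> bool"
  where "complex_linear L \<longleftrightarrow> (\<forall>x y. L (x + y) = L x + L y) \<and> (\<forall>c x. L (c *s x) = c *s L x)"

lemma complex_linear_scale: "complex_linear L \<Longrightarrow> L (c *s x) = c *s L x"
  by (simp add: complex_linear_def)

lemma complex_linear_0: "complex_linear L \<Longrightarrow> L 0 = 0"
  unfolding complex_linear_def by (metis vector_smult_lzero)

lemma holomorphic_map_on_differential:
  fixes F :: "complex^'n \<Rightarrow> complex^'m"
  assumes "holomorphic_map_on F U" "x \<in> U"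
  shows "\<exists>L. complex_linear L \<and> (\<forall>h z v. h z = x \<longrightarrow> has_curve_derivative h v z
    \<longrightarrow> has_curve_derivative (\<lambda>\<zeta>. F (h \<zeta>)) (L v) z)"
proof -
  have "\<forall>i. \<exists>f'. ((\<lambda>x. F x $ i) has_derivative f') (at x) \<and> (\<forall>c v. f' (c *s v) = c * f' v)"
    using assms by (simp add: holomorphic_map_on_def holomorphic_fun_on_def)
  then obtain l where l: "\<And>i. ((\<lambda>x. F x $ i) has_derivative l i) (at x)"
    "\<And>i c v. l i (c *s v) = c * l i v"
    by metis
  have "l i (v + w) = l i v + l i w" for i v w
    by (meson l(1) has_derivative_linear linear_add)
  then have "complex_linear (\<lambda>v. \<chi> i. l i v)"
    by (simp add: complex_linear_def vec_eq_iff l(2))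
  moreover have "has_curve_derivative (\<lambda>\<zeta>. F (h \<zeta>)) (\<chi> i. l i v) z"
    if "h z = x" "has_curve_derivative h v z" for h z v
    unfolding has_curve_derivative_def
    using has_derivative_along_curve[of "\<lambda>x. F x $ _" "l _" h z v] l that by simp
  ultimately show ?thesis by blast
qed

lemma holomorphic_map_on_imp_continuous_on:
  assumes "holomorphic_map_on F U"
  shows "continuous_on U F"
proof -
  have c: "continuous_on U (\<lambda>x. F x $ i)" for i
    using assms unfolding holomorphic_map_on_def holomorphic_fun_on_def
    by (meson continuous_at_imp_continuous_on has_derivative_continuous)
  have "continuous_on U (\<lambda>x. \<chi> i. F x $ i)"
    by (intro continuous_on_vec_lambda c)
  then show ?thesis by simp
qed

lemma holomorphic_map_on_cong:
  assumes "holomorphic_map_on F U" "open U" "\<And>x. x \<in> U \<Longrightarrow> F x = G x"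
  shows "holomorphic_map_on G U"
  unfolding holomorphic_map_on_def holomorphic_fun_on_def
proof (intro allI ballI)
  fix i x assume x: "x \<in> U"
  then obtain f' where f': "((\<lambda>x. F x $ i) has_derivative f') (at x)" "\<forall>c v. f' (c *s v) = c * f' v"
    using assms(1) unfolding holomorphic_map_on_def holomorphic_fun_on_def by blast
  have "((\<lambda>x. G x $ i) has_derivative f') (at x)"
    by (rule has_derivative_transform_within_open[OF f'(1) assms(2) x]) (simp add: assms(3))
  with f'(2) show "\<exists>f'. ((\<lambda>x. G x $ i) has_derivative f') (at x) \<and> (\<forall>c v. f' (c *s v) = c * f' v)"
    by blast
qed

named_theorems hol_fun_intros

lemma holomorphic_fun_on_component [hol_fun_intros]: "holomorphic_fun_on (\<lambda>x. x $ i) U"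
  unfolding holomorphic_fun_on_def
  by (auto intro!: exI[of _ "\<lambda>x. x $ i"] bounded_linear_imp_has_derivative bounded_linear_vec_nth)

lemma holomorphic_fun_on_const [hol_fun_intros]: "holomorphic_fun_on (\<lambda>x. c) U"
  unfolding holomorphic_fun_on_def by (auto intro!: exI[of _ "\<lambda>x. 0"] derivative_eq_intros)

lemma holomorphic_fun_on_add [hol_fun_intros]:
  assumes "holomorphic_fun_on f U" "holomorphic_fun_on g U"
  shows "holomorphic_fun_on (\<lambda>x. f x + g x) U"
  unfolding holomorphic_fun_on_def
proof
  fix x assume x: "x \<in> U"
  from assms x obtain f' g' where "(f has_derivative f') (at x)" "\<forall>c v. f' (c *s v) = c * f' v"
    "(g has_derivative g') (at x)" "\<forall>c v. g' (c *s v) = c * g' v"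
    unfolding holomorphic_fun_on_def by meson
  then show "\<exists>f'. ((\<lambda>x. f x + g x) has_derivative f') (at x) \<and> (\<forall>c v. f' (c *s v) = c * f' v)"
    by (intro exI[of _ "\<lambda>x. f' x + g' x"]) (auto intro!: has_derivative_add simp: algebra_simps)
qed

lemma holomorphic_fun_on_mult [hol_fun_intros]:
  assumes "holomorphic_fun_on f U" "holomorphic_fun_on g U"
  shows "holomorphic_fun_on (\<lambda>x. f x * g x) U"
  unfolding holomorphic_fun_on_def
proof
  fix x assume x: "x \<in> U"
  from assms x obtain f' g' where "(f has_derivative f') (at x)" "\<forall>c v. f' (c *s v) = c * f' v"
    "(g has_derivative g') (at x)" "\<forall>c v. g' (c *s v) = c * g' v"
    unfolding holomorphic_fun_on_def by meson
  then show "\<exists>f'. ((\<lambda>x. f x * g x) has_derivative f') (at x) \<and> (\<forall>c v. f' (c *s v) = c * f' v)"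
    by (intro exI[of _ "\<lambda>h. f x * g' h + f' h * g x"]) (auto intro!: has_derivative_mult simp: algebra_simps)
qed

lemma holomorphic_fun_on_inverse [hol_fun_intros]:
  assumes "holomorphic_fun_on f U" "\<And>x. x \<in> U \<Longrightarrow> f x \<noteq> 0"
  shows "holomorphic_fun_on (\<lambda>x. inverse (f x)) U"
  unfolding holomorphic_fun_on_def
proof
  fix x assume x: "x \<in> U"
  from assms x obtain f' where "(f has_derivative f') (at x)" "\<forall>c v. f' (c *s v) = c * f' v"
    unfolding holomorphic_fun_on_def by meson
  then show "\<exists>f'. ((\<lambda>x. inverse (f x)) has_derivative f') (at x) \<and> (\<forall>c v. f' (c *s v) = c * f' v)"
    using assms(2)[OF x]
    by (intro exI[of _ "\<lambda>h. - (inverse (f x) * f' h * inverse (f x))"])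
       (auto intro!: has_derivative_inverse)
qed

lemma holomorphic_fun_on_diff [hol_fun_intros]:
  assumes "holomorphic_fun_on f U" "holomorphic_fun_on g U"
  shows "holomorphic_fun_on (\<lambda>x. f x - g x) U"
  using holomorphic_fun_on_add[OF assms(1) holomorphic_fun_on_mult[OF holomorphic_fun_on_const[of "-1"] assms(2)]]
  by simp

lemma holomorphic_fun_on_divide [hol_fun_intros]:
  assumes "holomorphic_fun_on f U" "holomorphic_fun_on g U" "\<And>x. x \<in> U \<Longrightarrow> g x \<noteq> 0"
  shows "holomorphic_fun_on (\<lambda>x. f x / g x) U"
  using holomorphic_fun_on_mult[OF assms(1) holomorphic_fun_on_inverse[OF assms(2,3)]]
  by (simp add: divide_inverse)

section \<open>The symmetrized bidisc\<close>

definition symmetrize :: "complex \<Rightarrow> complex \<Rightarrow> complex^2"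
  where "symmetrize z w = vector [z + w, z * w]"

lemma symmetrize_nth [simp]: "symmetrize z w $ 1 = z + w" "symmetrize z w $ 2 = z * w"
  by (simp_all add: symmetrize_def)

lemma symmetrize_commute: "symmetrize z w = symmetrize w z"
  by (simp add: symmetrize_def add.commute mult.commute)

lemma vec2_eq_iff: "(x :: 'a^2) = y \<longleftrightarrow> x $ 1 = y $ 1 \<and> x $ 2 = y $ 2"
  by (simp add: vec_eq_iff forall_2)

lemma vieta_eq_iff:
  fixes z w x y :: "'a::idom"
  shows "z + w = x + y \<and> z * w = x * y \<longleftrightarrow> (z = x \<and> w = y) \<or> (z = y \<and> w = x)"
proof
  assume "z + w = x + y \<and> z * w = x * y"
  then have s: "w = x + y - z" by (metis add_diff_cancel_left')
  then have p: "z * (x + y - z) = x * y" using \<open>z + w = x + y \<and> z * w = x * y\<close> by simp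
  have "(z - x) * (z - y) = 0" using p by (simp add: algebra_simps)
  then show "(z = x \<and> w = y) \<or> (z = y \<and> w = x)" using s by auto
qed auto

lemma symmetrize_eq_iff:
  "symmetrize z w = symmetrize x y \<longleftrightarrow> (z = x \<and> w = y) \<or> (z = y \<and> w = x)"
  using vieta_eq_iff[of z w x y] by (simp add: vec2_eq_iff)

lemma symmetrize_surj: obtains z w where "(x :: complex^2) = symmetrize z w"
proof
  define d where "d = csqrt ((x $ 1)\<^sup>2 - 4 * x $ 2)"
  have d: "d\<^sup>2 = (x $ 1)\<^sup>2 - 4 * x $ 2" by (simp add: d_def)
  have "(x $ 1 + d) / 2 * ((x $ 1 - d) / 2) = ((x $ 1)\<^sup>2 - d\<^sup>2) / 4"
    by (simp add: field_simps power2_eq_square)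
  also have "\<dots> = x $ 2" by (simp add: d)
  finally show "x = symmetrize ((x $ 1 + d) / 2) ((x $ 1 - d) / 2)"
    by (simp add: vec2_eq_iff field_simps)
qed

lemma sym_bidisc_cases:
  assumes "x \<in> sym_bidisc" obtains z w where "z \<in> \<bbbD>" "w \<in> \<bbbD>" "x = symmetrize z w"
  using assms unfolding sym_bidisc_def symmetrize_def by blast

lemma symmetrize_in_sym_bidisc_iff: "symmetrize z w \<in> sym_bidisc \<longleftrightarrow> z \<in> \<bbbD> \<and> w \<in> \<bbbD>"
proof
  assume "symmetrize z w \<in> sym_bidisc"
  then show "z \<in> \<bbbD> \<and> w \<in> \<bbbD>" by (elim sym_bidisc_cases) (auto simp: symmetrize_eq_iff)
qed (auto simp: sym_bidisc_def symmetrize_def)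

lemma symmetrize_diagonal: "symmetrize z z = vector [2 * z, z\<^sup>2]"
  by (simp add: symmetrize_def power2_eq_square)

lemma symmetrize_in_royal_iff: "symmetrize z w \<in> royal \<longleftrightarrow> z \<in> \<bbbD> \<and> z = w"
  unfolding royal_def symmetrize_diagonal[symmetric] by (auto simp: symmetrize_eq_iff)

text \<open>By this identity the two root conditions \<open>|x| < 1\<close>, \<open>|y| < 1\<close> become one strict inequality between continuous
  functions of \<open>s = x + y\<close> and \<open>p = x y\<close>, which shows that the symmetrized bidisc is open.\<close>

lemma sym_bidisc_cut_identity:
  "x + y - cnj (x + y) * (x * y) = x * of_real (1 - (cmod y)\<^sup>2) + y * of_real (1 - (cmod x)\<^sup>2)"
proof -
  have "complex_of_real (1 - (cmod u)\<^sup>2) = 1 - u * cnj u" for u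
    by (simp only: of_real_diff of_real_1 complex_norm_square)
  then show ?thesis by (simp only: complex_cnj_add) (simp add: algebra_simps)
qed

lemma sym_bidisc_iff:
  fixes x :: "complex^2"
  shows
  "x \<in> sym_bidisc \<longleftrightarrow> cmod (x $ 1 - cnj (x $ 1) * x $ 2) < 1 - (cmod (x $ 2))\<^sup>2"
proof -
  have less: "cmod (x + y - cnj (x + y) * (x * y)) < 1 - (cmod (x * y))\<^sup>2" if "cmod x < 1" "cmod y < 1" for x y
  proof -
    have xy: "cmod x * cmod y < 1" using that mult_strict_mono[of "cmod x" 1 "cmod y" 1] by simp
    have "cmod (x + y - cnj (x + y) * (x * y)) \<le> cmod x * (1 - (cmod y)\<^sup>2) + cmod y * (1 - (cmod x)\<^sup>2)"
      unfolding sym_bidisc_cut_identity using that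
      by (intro order.trans[OF norm_triangle_ineq]) (simp add: norm_mult abs_square_le_1 del: of_real_diff of_real_power)
    also have "\<dots> = (cmod x + cmod y) * (1 - cmod x * cmod y)"
      by (simp add: algebra_simps power2_eq_square)
    also have "\<dots> < (1 + cmod x * cmod y) * (1 - cmod x * cmod y)"
    proof (intro mult_strict_right_mono)
      have "0 < (1 - cmod x) * (1 - cmod y)" using that by simp
      then show "cmod x + cmod y < 1 + cmod x * cmod y" by (simp add: algebra_simps)
    qed (use xy in simp)
    also have "\<dots> = 1 - (cmod (x * y))\<^sup>2"
      by (simp add: norm_mult algebra_simps power2_eq_square)
    finally show ?thesis .
  qed
  have inside: "cmod x < 1" if l: "cmod (x + y - cnj (x + y) * (x * y)) < 1 - (cmod (x * y))\<^sup>2" for x y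
  proof (rule ccontr)
    assume "\<not> cmod x < 1"
    then have x: "1 \<le> cmod x" by simp
    have "(cmod (x * y))\<^sup>2 < 1" using l norm_ge_zero[of "x + y - cnj (x + y) * (x * y)"] by linarith
    then have xy: "cmod x * cmod y < 1" by (simp add: abs_square_less_1 norm_mult)
    have y: "cmod y < 1"
      using x xy mult_right_mono[of 1 "cmod x" "cmod y"] by simp
    have "0 \<le> (cmod x - 1) * (1 - cmod y)" using x y by simp
    then have "(1 + cmod x * cmod y) * (1 - cmod x * cmod y) \<le> (cmod x + cmod y) * (1 - cmod x * cmod y)"
      using xy by (intro mult_right_mono) (auto simp: algebra_simps)
    also have "\<dots> = cmod x * (1 - (cmod y)\<^sup>2) - cmod y * ((cmod x)\<^sup>2 - 1)"
      by (simp add: algebra_simps power2_eq_square)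
    also have "\<dots> = cmod (x * of_real (1 - (cmod y)\<^sup>2)) - cmod (y * of_real (1 - (cmod x)\<^sup>2))"
    proof -
      have "\<bar>1 - (cmod y)\<^sup>2\<bar> = 1 - (cmod y)\<^sup>2" using y by (simp add: abs_square_le_1)
      moreover have "\<bar>1 - (cmod x)\<^sup>2\<bar> = (cmod x)\<^sup>2 - 1" using x by (simp add: one_le_power)
      ultimately show ?thesis unfolding norm_mult norm_of_real by simp
    qed
    also have "\<dots> \<le> cmod (x + y - cnj (x + y) * (x * y))"
      unfolding sym_bidisc_cut_identity by (rule norm_diff_ineq)
    finally show False using l by (simp add: norm_mult algebra_simps power2_eq_square)
  qed
  obtain z w where "x = symmetrize z w" by (rule symmetrize_surj)
  then show ?thesis
    using less[of z w] inside[of z w] inside[of w z]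
    by (auto simp: symmetrize_in_sym_bidisc_iff add.commute mult.commute)
qed

lemma open_sym_bidisc: "open sym_bidisc"
proof -
  have "open {x :: complex^2. cmod (x $ 1 - cnj (x $ 1) * x $ 2) < 1 - (cmod (x $ 2))\<^sup>2}"
    by (intro open_Collect_less continuous_intros)
  moreover have "sym_bidisc = {x :: complex^2. cmod (x $ 1 - cnj (x $ 1) * x $ 2) < 1 - (cmod (x $ 2))\<^sup>2}"
    using sym_bidisc_iff by blast
  ultimately show ?thesis by simp
qed

lemma sym_bidisc_norms:
  fixes x :: "complex^2"
  assumes "x \<in> sym_bidisc"
  shows "cmod (x $ 1) < 2" "cmod (x $ 2) < 1"
proof -
  obtain z w where zw: "z \<in> \<bbbD>" "w \<in> \<bbbD>" "x = symmetrize z w" using assms by (rule sym_bidisc_cases)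
  show "cmod (x $ 1) < 2" using zw norm_triangle_ineq[of z w] by simp
  show "cmod (x $ 2) < 1" using zw mult_strict_mono[of "cmod z" 1 "cmod w" 1] by (simp add: norm_mult)
qed

lemma continuous_on_symmetrize:
  assumes "continuous_on S f" "continuous_on S g"
  shows "continuous_on S (\<lambda>x. symmetrize (f x) (g x))"
proof -
  have "continuous_on S (\<lambda>x. \<chi> i::2. if i = 1 then f x + g x else f x * g x)"
  proof (intro continuous_on_vec_lambda)
    show "continuous_on S (\<lambda>x. if i = 1 then f x + g x else f x * g x)" for i :: 2
      by (cases "i = 1") (auto intro!: continuous_intros assms)
  qed
  moreover have "(\<chi> i::2. if i = 1 then f x + g x else f x * g x) = symmetrize (f x) (g x)" for x
    by (simp add: vec2_eq_iff)
  ultimately show ?thesis by simp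
qed

text \<open>For each \<open>\<omega>\<close> on the unit circle this maps the symmetrized bidisc to the disc. Its modulus
  tends to 1 when one of the two roots tends to \<open>cnj \<omega>\<close> and the other one stays away from it.\<close>

definition magic :: "complex \<Rightarrow> complex^2 \<Rightarrow> complex"
  where "magic \<omega> x = (2 * \<omega> * x $ 2 - x $ 1) / (2 - \<omega> * x $ 1)"

lemma magic_defect:
  "(cmod (2 - a - b))\<^sup>2 - (cmod (2 * a * b - a - b))\<^sup>2
     = 2 * (1 - (cmod a)\<^sup>2) * (cmod (1 - b))\<^sup>2 + 2 * (1 - (cmod b)\<^sup>2) * (cmod (1 - a))\<^sup>2"
  by (simp add: cmod_power2) (simp add: power2_eq_square algebra_simps)

lemma magic_defect_symmetrize:
  assumes "cmod \<omega> = 1"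
  shows "(cmod (2 - \<omega> * symmetrize z w $ 1))\<^sup>2 - (cmod (2 * \<omega> * symmetrize z w $ 2 - symmetrize z w $ 1))\<^sup>2
     = 2 * (1 - (cmod z)\<^sup>2) * (cmod (1 - \<omega> * w))\<^sup>2 + 2 * (1 - (cmod w)\<^sup>2) * (cmod (1 - \<omega> * z))\<^sup>2"
proof -
  have "2 * (\<omega> * z) * (\<omega> * w) - \<omega> * z - \<omega> * w = \<omega> * (2 * \<omega> * (z * w) - (z + w))"
    by (simp add: algebra_simps)
  then have n: "cmod (2 * (\<omega> * z) * (\<omega> * w) - \<omega> * z - \<omega> * w) = cmod (2 * \<omega> * (z * w) - (z + w))"
    using assms by (simp add: norm_mult)
  have d: "2 - \<omega> * z - \<omega> * w = 2 - \<omega> * (z + w)" by (simp add: algebra_simps)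
  show ?thesis
    using magic_defect[of "\<omega> * z" "\<omega> * w"] assms unfolding n d by (simp add: norm_mult)
qed

lemma magic_denominator:
  fixes x :: "complex^2"
  assumes "cmod \<omega> = 1" "x \<in> sym_bidisc"
  shows "2 - \<omega> * x $ 1 \<noteq> 0"
proof
  assume "2 - \<omega> * x $ 1 = 0"
  then have "cmod (\<omega> * x $ 1) = 2" by (metis eq_iff_diff_eq_0 norm_numeral)
  then show False using assms sym_bidisc_norms(1)[OF assms(2)] by (simp add: norm_mult)
qed

lemma magic_in_disc:
  fixes x :: "complex^2"
  assumes "cmod \<omega> = 1" "x \<in> sym_bidisc"
  shows "magic \<omega> x \<in> \<bbbD>"
proof -
  obtain z w where zw: "z \<in> \<bbbD>" "w \<in> \<bbbD>" "x = symmetrize z w" using assms(2) by (rule sym_bidisc_cases)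
  have nz: "cmod (1 - \<omega> * u) > 0" if "u \<in> \<bbbD>" for u
  proof -
    have "cmod (\<omega> * u) < 1" using that assms(1) by (simp add: norm_mult)
    then show ?thesis by auto
  qed
  have "0 < 2 * (1 - (cmod z)\<^sup>2) * (cmod (1 - \<omega> * w))\<^sup>2 + 2 * (1 - (cmod w)\<^sup>2) * (cmod (1 - \<omega> * z))\<^sup>2"
    using zw(1,2) nz[OF zw(1)] nz[OF zw(2)]
    by (intro add_pos_pos mult_pos_pos zero_less_power) (auto simp: abs_square_less_1)
  then have "(cmod (2 * \<omega> * x $ 2 - x $ 1))\<^sup>2 < (cmod (2 - \<omega> * x $ 1))\<^sup>2"
    using magic_defect_symmetrize[OF assms(1), of z w] zw(3) by simp
  then have "cmod (2 * \<omega> * x $ 2 - x $ 1) < cmod (2 - \<omega> * x $ 1)"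
    by (rule power_less_imp_less_base) simp
  then show ?thesis
    using magic_denominator[OF assms] by (simp add: magic_def norm_divide divide_less_eq)
qed

section \<open>Two facts on holomorphic functions on the disc\<close>

lemma holomorphic_zero_if_zero_boundary:
  assumes u: "u holomorphic_on \<bbbD>"
    and lim: "\<And>\<epsilon>. \<epsilon> > 0 \<Longrightarrow> \<exists>\<rho><1. \<forall>w\<in>\<bbbD>. \<rho> < cmod w \<longrightarrow> cmod (u w) \<le> \<epsilon>"
    and w: "w \<in> \<bbbD>"
  shows "u w = 0"
proof -
  have "cmod (u w) \<le> \<epsilon>" if \<epsilon>: "\<epsilon> > 0" for \<epsilon>
  proof -
    obtain \<rho> where \<rho>: "\<rho> < 1" "\<And>w. w \<in> \<bbbD> \<Longrightarrow> \<rho> < cmod w \<Longrightarrow> cmod (u w) \<le> \<epsilon>"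
      using lim[OF \<epsilon>] by blast
    define t where "t = (1 + max \<rho> (cmod w)) / 2"
    have t: "t < 1" "\<rho> < t" "cmod w < t" using \<rho>(1) w by (auto simp: t_def max_def)
    have sub: "cball 0 t \<subseteq> \<bbbD>" using t by auto
    show ?thesis
    proof (rule maximum_modulus_frontier[of u "cball 0 t"])
      show "u holomorphic_on interior (cball 0 t)"
        using u sub interior_subset holomorphic_on_subset by (metis order.trans)
      show "continuous_on (closure (cball 0 t)) u"
        using u sub by (auto intro: holomorphic_on_imp_continuous_on holomorphic_on_subset)
      show "cmod (u z) \<le> \<epsilon>" if "z \<in> frontier (cball 0 t)" for z
        using that t \<rho>(2)[of z] by simp
    qed (use t in auto)
  qed
  then have "cmod (u w) \<le> 0" by (meson dense_ge)
  then show ?thesis by simp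
qed

text \<open>Connectedness of the disc: the ring of holomorphic functions on it has no zero divisors.\<close>

lemma holomorphic_mult_eq_0:
  assumes u: "u holomorphic_on \<bbbD>" and v: "v holomorphic_on \<bbbD>"
    and uv: "\<And>w. w \<in> \<bbbD> \<Longrightarrow> u w * v w = 0"
  shows "(\<forall>w\<in>\<bbbD>. u w = 0) \<or> (\<forall>w\<in>\<bbbD>. v w = 0)"
proof (rule disjCI)
  assume "\<not> (\<forall>w\<in>\<bbbD>. v w = 0)"
  then have ne: "\<bbbD> \<inter> v -` (- {0}) \<noteq> {}" by auto
  have op: "open (\<bbbD> \<inter> v -` (- {0}))"
    by (rule continuous_open_preimage) (auto intro: holomorphic_on_imp_continuous_on v)
  have z: "u z = 0" if "z \<in> \<bbbD> \<inter> v -` (- {0})" for z using uv[of z] that by auto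
  show "\<forall>w\<in>\<bbbD>. u w = 0"
    using analytic_continuation_open[OF op _ ne _ _ u holomorphic_on_const[of 0]] z by simp
qed

section \<open>The boundary estimate\<close>

text \<open>The directions \<open>(1, x)\<close> and \<open>(1, y)\<close> of the two leaves through \<open>symmetrize x y\<close> are the null directions of this form.\<close>

definition leaf_form :: "complex^2 \<Rightarrow> complex^2 \<Rightarrow> complex"
  where "leaf_form x v = (v $ 2)\<^sup>2 - x $ 1 * v $ 1 * v $ 2 + x $ 2 * (v $ 1)\<^sup>2"

lemma leaf_form_symmetrize:
  "leaf_form (symmetrize x y) v = (v $ 2 - x * v $ 1) * (v $ 2 - y * v $ 1)"
  by (simp add: leaf_form_def algebra_simps power2_eq_square)

definition discrim :: "complex^2 \<Rightarrow> complex"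
  where "discrim x = (x $ 1)\<^sup>2 - 4 * x $ 2"

lemma discrim_symmetrize: "discrim (symmetrize x y) = (x - y)\<^sup>2"
  by (simp add: discrim_def algebra_simps power2_eq_square)

definition disc_in_sym_bidisc :: "(complex \<Rightarrow> complex^2) \<Rightarrow> bool"
  where "disc_in_sym_bidisc h \<longleftrightarrow>
    (\<forall>i. (\<lambda>z. h z $ i) holomorphic_on \<bbbD>) \<and> h ` \<bbbD> \<subseteq> sym_bidisc"

lemma disc_in_sym_bidisc_deriv_bounds:
  assumes h: "disc_in_sym_bidisc h" and z: "z \<in> \<bbbD>"
  shows "cmod (curve_deriv h z $ 1) * (1 - (cmod z)\<^sup>2) \<le> 2"
    and "cmod (curve_deriv h z $ 2) * (1 - (cmod z)\<^sup>2) \<le> 1"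
proof -
  have hol: "(\<lambda>z. h z $ i) holomorphic_on \<bbbD>" for i using h by (simp add: disc_in_sym_bidisc_def)
  have G: "h z \<in> sym_bidisc" if "z \<in> \<bbbD>" for z using h that by (auto simp: disc_in_sym_bidisc_def)
  have 1: "(\<lambda>z. h z $ 1 / 2) ` \<bbbD> \<subseteq> \<bbbD>"
    using sym_bidisc_norms(1)[OF G] by (auto simp: norm_divide)
  have 2: "(\<lambda>z. h z $ 2) ` \<bbbD> \<subseteq> \<bbbD>"
    using sym_bidisc_norms(2)[OF G] by auto
  have "((\<lambda>z. h z $ 1 / 2) has_field_derivative curve_deriv h z $ 1 / 2) (at z)"
    by (intro DERIV_cdivide has_curve_derivative_nth[OF has_curve_derivative_curve_deriv[OF hol _ z]]) simp
  then have d: "deriv (\<lambda>z. h z $ 1 / 2) z = curve_deriv h z $ 1 / 2" by (rule DERIV_imp_deriv)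
  have "(\<lambda>z. h z $ 1 / 2) holomorphic_on \<bbbD>" by (intro holomorphic_intros hol) simp
  from schwarz_pick_deriv[OF this 1 z]
  have "cmod (curve_deriv h z $ 1) / 2 * (1 - (cmod z)\<^sup>2) \<le> 1 - (cmod (h z $ 1 / 2))\<^sup>2"
    unfolding d by (simp add: norm_divide)
  then show "cmod (curve_deriv h z $ 1) * (1 - (cmod z)\<^sup>2) \<le> 2"
    using zero_le_power2[of "cmod (h z $ 1 / 2)"] by linarith
  have "cmod (curve_deriv h z $ 2) * (1 - (cmod z)\<^sup>2) \<le> 1 - (cmod (h z $ 2))\<^sup>2"
    using schwarz_pick_deriv[OF hol 2 z] by (simp add: curve_deriv_def)
  then show "cmod (curve_deriv h z $ 2) * (1 - (cmod z)\<^sup>2) \<le> 1"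
    using zero_le_power2[of "cmod (h z $ 2)"] by linarith
qed

text \<open>Schwarz--Pick for \<open>magic \<omega> \<circ> h\<close> after multiplication by the squared denominator; in this form nothing degenerates where the denominator is small.\<close>

lemma magic_deriv_estimate:
  fixes h :: "complex \<Rightarrow> complex^2" and v :: "complex^2"
  assumes h: "disc_in_sym_bidisc h" and z: "z \<in> \<bbbD>" and \<omega>: "cmod \<omega> = 1"
  defines "v \<equiv> curve_deriv h z"
  shows "2 * cmod (\<omega> * (2 - \<omega> * h z $ 1) * v $ 2 - (1 - \<omega>\<^sup>2 * h z $ 2) * v $ 1) * (1 - (cmod z)\<^sup>2)
     \<le> (cmod (2 - \<omega> * h z $ 1))\<^sup>2 - (cmod (2 * \<omega> * h z $ 2 - h z $ 1))\<^sup>2"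
proof -
  have hol: "(\<lambda>z. h z $ i) holomorphic_on \<bbbD>" for i using h by (simp add: disc_in_sym_bidisc_def)
  have G: "h z \<in> sym_bidisc" if "z \<in> \<bbbD>" for z using h that by (auto simp: disc_in_sym_bidisc_def)
  have nz: "2 - \<omega> * h z $ 1 \<noteq> 0" if "z \<in> \<bbbD>" for z
    by (rule magic_denominator[OF \<omega> G[OF that]])
  let ?d = "2 - \<omega> * h z $ 1" and ?n = "2 * \<omega> * h z $ 2 - h z $ 1"
  let ?E = "\<omega> * ?d * v $ 2 - (1 - \<omega>\<^sup>2 * h z $ 2) * v $ 1"
  have dv: "((\<lambda>\<zeta>. h \<zeta> $ i) has_field_derivative v $ i) (at z)" for i
    unfolding v_def by (rule has_curve_derivative_nth[OF has_curve_derivative_curve_deriv[OF hol _ z]]) simp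
  have "((\<lambda>\<zeta>. magic \<omega> (h \<zeta>)) has_field_derivative
      ((2 * \<omega> * v $ 2 - v $ 1) * ?d - ?n * (- (\<omega> * v $ 1))) / (?d * ?d)) (at z)"
    unfolding magic_def using nz[OF z] by (auto intro!: derivative_eq_intros dv)
  moreover have "(2 * \<omega> * v $ 2 - v $ 1) * ?d - ?n * (- (\<omega> * v $ 1)) = 2 * ?E"
    by (simp add: algebra_simps power2_eq_square)
  ultimately have der: "deriv (\<lambda>\<zeta>. magic \<omega> (h \<zeta>)) z = 2 * ?E / (?d * ?d)"
    by (simp add: DERIV_imp_deriv)
  have "(\<lambda>\<zeta>. magic \<omega> (h \<zeta>)) holomorphic_on \<bbbD>"
    unfolding magic_def by (intro holomorphic_intros hol nz)
  moreover have "(\<lambda>\<zeta>. magic \<omega> (h \<zeta>)) ` \<bbbD> \<subseteq> \<bbbD>"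
    using magic_in_disc[OF \<omega> G] by blast
  ultimately have sp: "cmod (2 * ?E / (?d * ?d)) * (1 - (cmod z)\<^sup>2) \<le> 1 - (cmod (?n / ?d))\<^sup>2"
    using schwarz_pick_deriv[OF _ _ z] unfolding der[symmetric] magic_def[symmetric] by blast
  have pos: "(cmod ?d)\<^sup>2 > 0" using nz[OF z] by simp
  have l: "cmod (2 * ?E / (?d * ?d)) * (1 - (cmod z)\<^sup>2) * (cmod ?d)\<^sup>2
      = 2 * cmod ?E * (1 - (cmod z)\<^sup>2)"
    using nz[OF z] unfolding norm_divide norm_mult[of "2::complex"] norm_mult[of ?d ?d] power2_eq_square
    by (simp del: norm_mult)
  have r: "(1 - (cmod (?n / ?d))\<^sup>2) * (cmod ?d)\<^sup>2 = (cmod ?d)\<^sup>2 - (cmod ?n)\<^sup>2"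
    using pos by (simp add: norm_divide power_divide field_simps)
  show ?thesis
    using mult_right_mono[OF sp, of "(cmod ?d)\<^sup>2"] unfolding l r by simp
qed

text \<open>A disc that passes near the boundary of the symmetrized bidisc, that is, with a root \<open>x\<close> of modulus near 1,
  is nearly null. For \<open>\<omega>\<close> with \<open>\<omega> x = |x|\<close>, the deficiency of \<open>magic \<omega>\<close> from modulus 1, cleared of denominators, is of order
  \<open>1 - |x|\<close>, and by Schwarz--Pick so is the numerator of its derivative along the disc. Up to an error of order \<open>1 - |x|\<close>, this numerator is the factor \<open>v\<^sub>2 - x v\<^sub>1\<close>
  of the form times \<open>x - y\<close>. The discriminant \<open>(x - y)\<^sup>2\<close> supplies the factors \<open>x - y\<close>. Of the constant 114 only its independence of the disc matters.\<close>

lemma leaf_form_boundary_estimate: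
  assumes h: "disc_in_sym_bidisc h" and z: "z \<in> \<bbbD>"
    and hz: "h z = symmetrize x y" and xy: "cmod y \<le> cmod x"
  shows "cmod (discrim (h z) * leaf_form (h z) (curve_deriv h z)) * (1 - (cmod z)\<^sup>2)\<^sup>2 \<le> 114 * (1 - cmod x)"
proof -
  define v where "v = curve_deriv h z"
  define \<delta> where "\<delta> = 1 - (cmod z)\<^sup>2"
  define r where "r = cmod x"
  have "h z \<in> sym_bidisc" using h z by (auto simp: disc_in_sym_bidisc_def)
  then have x1: "cmod x < 1" and y1: "cmod y < 1" unfolding hz symmetrize_in_sym_bidisc_iff by auto
  have r01: "0 \<le> r" "r < 1" using x1 by (auto simp: r_def)
  have \<delta>: "0 < \<delta>" using z by (simp add: \<delta>_def abs_square_less_1)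
  have v: "cmod (v $ 1) * \<delta> \<le> 2" "cmod (v $ 2) * \<delta> \<le> 1"
    using disc_in_sym_bidisc_deriv_bounds[OF h z] by (simp_all add: v_def \<delta>_def)
  obtain \<omega> where \<omega>: "cmod \<omega> = 1" "\<omega> * x = of_real r"
  proof (cases "x = 0")
    case False
    show ?thesis
    proof (rule that[of "cnj x / of_real (cmod x)"])
      show "cmod (cnj x / of_real (cmod x)) = 1" using False by (simp add: norm_divide)
      have "cnj x * x = of_real r * of_real r"
        by (metis complex_norm_square mult.commute of_real_mult power2_eq_square r_def)
      then show "cnj x / of_real (cmod x) * x = of_real r" using False by (simp add: r_def)
    qed
  qed (use that[of 1] in \<open>auto simp: r_def\<close>)
  \<comment> \<open>\<open>E\<close> is half the numerator of the derivative of \<open>magic \<omega> \<circ> h\<close>; for \<open>|x| = 1\<close> the numbers \<open>x\<^sup>2 E\<close> and \<open>E'\<close> agree.\<close>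
  define E where "E = \<omega> * (2 - \<omega> * (x + y)) * v $ 2 - (1 - \<omega>\<^sup>2 * (x * y)) * v $ 1"
  define E' where "E' = (x - y) * (v $ 2 - x * v $ 1)"
  have "2 * cmod E * \<delta> \<le> 2 * (1 - r\<^sup>2) * (cmod (1 - \<omega> * y))\<^sup>2 + 2 * (1 - (cmod y)\<^sup>2) * (cmod (1 - \<omega> * x))\<^sup>2"
    using magic_deriv_estimate[OF h z \<omega>(1)] magic_defect_symmetrize[OF \<omega>(1), of x y]
    unfolding hz by (simp add: E_def v_def \<delta>_def r_def)
  also have "\<dots> \<le> 2 * (2 * (1 - r)) * 2\<^sup>2 + 2 * 1 * (1 - r)"
  proof (intro add_mono mult_mono)
    have "(1 + r) * (1 - r) \<le> 2 * (1 - r)" using r01 by (intro mult_right_mono) auto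
    then show "1 - r\<^sup>2 \<le> 2 * (1 - r)" by (simp add: algebra_simps power2_eq_square)
    have "cmod (1 - \<omega> * y) \<le> 2"
      using norm_triangle_ineq4[of 1 "\<omega> * y"] \<omega>(1) y1 by (simp add: norm_mult)
    then show "(cmod (1 - \<omega> * y))\<^sup>2 \<le> 2\<^sup>2" by (intro power_mono) auto
    have "cmod (1 - \<omega> * x) = 1 - r"
      unfolding \<omega>(2) using r01 by (metis abs_of_nonneg diff_ge_0_iff_ge less_imp_le norm_of_real of_real_1 of_real_diff)
    moreover have "(1 - r)\<^sup>2 \<le> 1 - r" using r01 by (simp add: power2_eq_square mult_left_le)
    ultimately show "(cmod (1 - \<omega> * x))\<^sup>2 \<le> 1 - r" by simp
  qed (use r01 y1 in \<open>auto simp: abs_square_le_1\<close>)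
  finally have E: "cmod E * \<delta> \<le> 9 * (1 - r)" by simp
  have diff: "E' - x\<^sup>2 * E = of_real (1 - r) * ((2 * x - (1 + of_real r) * (x + y)) * v $ 2 + (1 + of_real r) * (x * y) * v $ 1)"
  proof -
    have "x\<^sup>2 * E = (\<omega> * x) * (2 * x - (\<omega> * x) * (x + y)) * v $ 2 - (x\<^sup>2 - (\<omega> * x)\<^sup>2 * (x * y)) * v $ 1"
      by (simp add: E_def algebra_simps power2_eq_square)
    then show ?thesis
      unfolding \<omega>(2) by (simp add: E'_def algebra_simps power2_eq_square)
  qed
  have n1: "cmod (1 + of_real r :: complex) \<le> 2"
    using norm_triangle_ineq[of 1 "of_real r :: complex"] r01 by simp
  have n2: "cmod (x + y) \<le> 2" using norm_triangle_ineq[of x y] x1 y1 by linarith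
  have n3: "cmod (2 * x - (1 + of_real r) * (x + y)) \<le> 6"
  proof -
    have "cmod ((1 + of_real r) * (x + y)) \<le> 2 * 2"
      unfolding norm_mult by (intro mult_mono n1 n2) auto
    then show ?thesis
      using norm_triangle_ineq4[of "2 * x" "(1 + of_real r) * (x + y)"] x1 by (simp add: norm_mult)
  qed
  have n4: "cmod ((1 + of_real r) * (x * y)) \<le> 2"
  proof -
    have "cmod ((1 + of_real r) * (x * y)) \<le> 2 * (1 * 1)"
      unfolding norm_mult using x1 y1 by (intro mult_mono n1) auto
    then show ?thesis by simp
  qed
  have "cmod (E' - x\<^sup>2 * E) \<le> (1 - r) * (6 * cmod (v $ 2) + 2 * cmod (v $ 1))"
  proof -
    have "cmod ((2 * x - (1 + of_real r) * (x + y)) * v $ 2 + (1 + of_real r) * (x * y) * v $ 1)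
      \<le> 6 * cmod (v $ 2) + 2 * cmod (v $ 1)"
      by (rule order.trans[OF norm_triangle_ineq])
         (unfold norm_mult[of _ "v $ 1"] norm_mult[of _ "v $ 2"], intro add_mono mult_right_mono n3 n4 norm_ge_zero)
    then show ?thesis
      unfolding diff norm_mult[of "of_real (1 - r)"] norm_of_real using r01 by (simp add: mult_left_mono)
  qed
  then have "cmod (E' - x\<^sup>2 * E) * \<delta> \<le> (1 - r) * (6 * cmod (v $ 2) + 2 * cmod (v $ 1)) * \<delta>"
    using \<delta> by (intro mult_right_mono) auto
  also have "\<dots> = (1 - r) * (6 * (cmod (v $ 2) * \<delta>) + 2 * (cmod (v $ 1) * \<delta>))"
    by (simp add: algebra_simps)
  also have "\<dots> \<le> (1 - r) * (6 * 1 + 2 * 2)"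
    using r01 by (intro mult_left_mono add_mono v) auto
  finally have d: "cmod (E' - x\<^sup>2 * E) * \<delta> \<le> 10 * (1 - r)" by simp
  have "cmod (x\<^sup>2 * E) \<le> 1 * cmod E"
    unfolding norm_mult norm_power using x1 by (intro mult_right_mono) (auto simp: abs_square_le_1)
  then have "cmod E' \<le> cmod (E' - x\<^sup>2 * E) + cmod E"
    using norm_triangle_ineq[of "E' - x\<^sup>2 * E" "x\<^sup>2 * E"] by simp
  then have "cmod E' * \<delta> \<le> (cmod (E' - x\<^sup>2 * E) + cmod E) * \<delta>"
    using \<delta> by (intro mult_right_mono) auto
  with E d have E': "cmod E' * \<delta> \<le> 19 * (1 - r)" by (simp add: algebra_simps)
  have "cmod ((x - y) * (v $ 2 - y * v $ 1)) * \<delta> \<le> 6"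
  proof -
    have "cmod (v $ 2 - y * v $ 1) \<le> cmod (v $ 2) + 1 * cmod (v $ 1)"
      using y1 by (intro order.trans[OF norm_triangle_ineq4]) (auto simp: norm_mult mult_left_le_one_le)
    then have "cmod (v $ 2 - y * v $ 1) * \<delta> \<le> (cmod (v $ 2) + 1 * cmod (v $ 1)) * \<delta>"
      using \<delta> by (intro mult_right_mono) auto
    then have "cmod (v $ 2 - y * v $ 1) * \<delta> \<le> 3"
      using v by (simp add: algebra_simps)
    moreover have "cmod (x - y) \<le> 2" using norm_triangle_ineq4[of x y] x1 y1 by linarith
    ultimately have "cmod (x - y) * (cmod (v $ 2 - y * v $ 1) * \<delta>) \<le> 2 * 3"
      using \<delta> by (intro mult_mono) auto
    then show ?thesis by (simp add: norm_mult)
  qed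
  then have "(cmod E' * \<delta>) * (cmod ((x - y) * (v $ 2 - y * v $ 1)) * \<delta>) \<le> (19 * (1 - r)) * 6"
    using \<delta> r01 by (intro mult_mono E') auto
  moreover have "discrim (h z) * leaf_form (h z) v = E' * ((x - y) * (v $ 2 - y * v $ 1))"
    unfolding hz discrim_symmetrize leaf_form_symmetrize by (simp add: E'_def power2_eq_square)
  ultimately show ?thesis
    unfolding v_def[symmetric] \<delta>_def[symmetric] r_def[symmetric]
    by (simp add: norm_mult power2_eq_square mult_ac)
qed

section \<open>Automorphisms of the symmetrized bidisc\<close>

text \<open>An automorphism is presented together with its inverse, so that each result about \<open>F\<close> is available for \<open>K\<close> too.\<close>

locale sym_bidisc_automorphism =
  fixes F K :: "complex^2 \<Rightarrow> complex^2"
  assumes F_hol: "holomorphic_map_on F sym_bidisc" and K_hol: "holomorphic_map_on K sym_bidisc"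
    and F_in: "x \<in> sym_bidisc \<Longrightarrow> F x \<in> sym_bidisc" and K_in: "x \<in> sym_bidisc \<Longrightarrow> K x \<in> sym_bidisc"
    and KF: "x \<in> sym_bidisc \<Longrightarrow> K (F x) = x" and FK: "x \<in> sym_bidisc \<Longrightarrow> F (K x) = x"
begin

text \<open>The image under \<open>F\<close> of the leaf with parameter \<open>w\<close>.\<close>

definition leaf :: "complex \<Rightarrow> complex \<Rightarrow> complex^2"
  where "leaf w z = F (symmetrize z w)"

abbreviation leaf_velocity :: "complex \<Rightarrow> complex \<Rightarrow> complex^2"
  where "leaf_velocity w z \<equiv> curve_deriv (leaf w) z"

lemma swap: "sym_bidisc_automorphism K F"
  using F_hol K_hol F_in K_in KF FK by unfold_locales

lemma leaf_commute: "leaf w z = leaf z w"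
  by (simp add: leaf_def symmetrize_commute)

lemma symmetrize_has_curve_derivative:
  "has_curve_derivative (\<lambda>\<zeta>. symmetrize \<zeta> w) (vector [1, w]) z"
  unfolding has_curve_derivative_def forall_2 by (auto intro!: derivative_eq_intros)

lemma leaf_has_curve_derivative:
  assumes z: "z \<in> \<bbbD>" and w: "w \<in> \<bbbD>"
  shows "has_curve_derivative (leaf w) (leaf_velocity w z) z"
proof -
  have "symmetrize z w \<in> sym_bidisc" using z w by (simp add: symmetrize_in_sym_bidisc_iff)
  from holomorphic_map_on_differential[OF F_hol this] obtain v where "has_curve_derivative (leaf w) v z"
    unfolding leaf_def using symmetrize_has_curve_derivative by metis
  then show ?thesis using has_curve_derivative_imp_curve_deriv by blast
qed

lemmas leaf_has_derivative = has_curve_derivative_nth[OF leaf_has_curve_derivative]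

lemma leaf_in: "z \<in> \<bbbD> \<Longrightarrow> w \<in> \<bbbD> \<Longrightarrow> leaf w z \<in> sym_bidisc"
  by (simp add: leaf_def F_in symmetrize_in_sym_bidisc_iff)

lemma leaf_holomorphic:
  assumes w: "w \<in> \<bbbD>" shows "(\<lambda>z. leaf w z $ i) holomorphic_on \<bbbD>"
  using leaf_has_derivative[OF _ w]
  by (meson field_differentiable_at_within field_differentiable_def holomorphic_on_def)

lemma leaf_disc: "w \<in> \<bbbD> \<Longrightarrow> disc_in_sym_bidisc (leaf w)"
  unfolding disc_in_sym_bidisc_def using leaf_holomorphic leaf_in by auto

lemma leaf_velocity_holomorphic:
  assumes w: "w \<in> \<bbbD>" shows "(\<lambda>z. leaf_velocity w z $ i) holomorphic_on \<bbbD>"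
  unfolding curve_deriv_def using holomorphic_deriv[OF leaf_holomorphic[OF w]] by simp

text \<open>The first coordinate is bounded by 2, so the coordinates are halved to have values in the disc.\<close>

lemma leaf_velocity_holomorphic_parameter:
  assumes z: "z \<in> \<bbbD>" shows "(\<lambda>w. leaf_velocity w z $ i) holomorphic_on \<bbbD>"
proof -
  have b: "leaf w z $ i / 2 \<in> \<bbbD>" if "z \<in> \<bbbD>" "w \<in> \<bbbD>" for z w
  proof -
    have "i = 1 \<or> i = 2" by (rule exhaust_2)
    then show ?thesis using sym_bidisc_norms[OF leaf_in[OF that]] by (auto simp: norm_divide)
  qed
  have "(\<lambda>w. deriv (\<lambda>z. leaf w z $ i / 2) z) holomorphic_on \<bbbD>"
  proof (rule deriv_holomorphic_in_parameter[OF _ _ b z])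
    show "(\<lambda>z. leaf w z $ i / 2) holomorphic_on \<bbbD>" if "w \<in> \<bbbD>" for w
      using that by (intro holomorphic_intros leaf_holomorphic) auto
    show "(\<lambda>w. leaf w z $ i / 2) holomorphic_on \<bbbD>" if "z \<in> \<bbbD>" for z
      unfolding leaf_commute[of _ z] using that by (intro holomorphic_intros leaf_holomorphic) auto
  qed
  then have "(\<lambda>w. 2 * deriv (\<lambda>z. leaf w z $ i / 2) z) holomorphic_on \<bbbD>"
    by (intro holomorphic_intros)
  moreover have "2 * deriv (\<lambda>z. leaf w z $ i / 2) z = leaf_velocity w z $ i" if "w \<in> \<bbbD>" for w
    using DERIV_imp_deriv[OF DERIV_cdivide[OF leaf_has_derivative[OF z that]]] by simp
  ultimately show ?thesis
    by (rule holomorphic_transform)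
qed

text \<open>Properness of \<open>F\<close>. The points whose two roots have modulus at most \<open>1 - \<epsilon>\<close> form a compact set, so do their preimages, and
  \<open>symmetrize z w\<close> leaves every compact subset of the symmetrized bidisc as \<open>w\<close> tends to the circle.\<close>

lemma leaf_proper:
  assumes z: "z \<in> \<bbbD>" and \<epsilon>: "\<epsilon> > 0"
  shows "\<exists>\<rho><1. \<forall>w\<in>\<bbbD>. \<rho> < cmod w \<longrightarrow>
    (\<forall>x y. leaf w z = symmetrize x y \<longrightarrow> cmod y \<le> cmod x \<longrightarrow> 1 - \<epsilon> < cmod x)"
proof -
  \<comment> \<open>The minimum keeps the radius nonnegative when \<open>\<epsilon> > 1\<close>.\<close>
  define C where "C = cball (0::complex) (1 - min \<epsilon> 1)"
  have C: "C \<subseteq> \<bbbD>" using \<epsilon> by (auto simp: C_def)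
  define P where "P = (\<lambda>(x, y). symmetrize x y) ` (C \<times> C)"
  have P: "compact P" "P \<subseteq> sym_bidisc"
  proof -
    have "continuous_on (C \<times> C) (\<lambda>q. symmetrize (fst q) (snd q))"
      by (intro continuous_on_symmetrize continuous_intros)
    then have "continuous_on (C \<times> C) (\<lambda>(x, y). symmetrize x y)"
      by (simp add: case_prod_unfold)
    then show "compact P"
      unfolding P_def by (intro compact_continuous_image compact_Times) (simp_all add: C_def)
    show "P \<subseteq> sym_bidisc"
      using C unfolding P_def by (auto simp: symmetrize_in_sym_bidisc_iff dest!: subsetD[OF C])
  qed
  have KP: "compact (K ` P)" "K ` P \<subseteq> sym_bidisc"
    using P K_in continuous_on_subset[OF holomorphic_map_on_imp_continuous_on[OF K_hol] P(2)]
    by (auto intro: compact_continuous_image)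
  define W where "W = cball 0 1 \<inter> symmetrize z -` (K ` P)"
  have "continuous_on (cball 0 1) (symmetrize z)"
    using continuous_on_symmetrize[OF continuous_on_const continuous_on_id] by simp
  then have "closed W"
    unfolding W_def by (intro continuous_closed_preimage compact_imp_closed KP) auto
  then have W: "compact W"
    unfolding W_def by (metis bounded_Int bounded_cball compact_eq_bounded_closed)
  have W1: "W \<subseteq> \<bbbD>"
  proof
    fix w assume "w \<in> W"
    then have "symmetrize z w \<in> sym_bidisc" using KP(2) unfolding W_def by blast
    then show "w \<in> \<bbbD>" by (simp only: symmetrize_in_sym_bidisc_iff)
  qed
  obtain \<rho> where \<rho>: "\<rho> < 1" "\<And>w. w \<in> W \<Longrightarrow> cmod w \<le> \<rho>"
  proof (cases "W = {}")
    case False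
    obtain w0 where "w0 \<in> W" "\<And>w. w \<in> W \<Longrightarrow> cmod w \<le> cmod w0"
      using continuous_attains_sup[OF W False, of cmod] continuous_on_norm_id by blast
    then show ?thesis using W1 that[of "cmod w0"] by auto
  qed (use that[of 0] in auto)
  show ?thesis
  proof (intro exI[of _ \<rho>] conjI ballI impI allI \<rho>(1))
    fix w x y
    assume w: "w \<in> \<bbbD>" and l: "\<rho> < cmod w" and xy: "leaf w z = symmetrize x y" "cmod y \<le> cmod x"
    show "1 - \<epsilon> < cmod x"
    proof (rule ccontr)
      assume "\<not> 1 - \<epsilon> < cmod x"
      then have x: "cmod x \<le> 1 - \<epsilon>" by simp
      then have "\<epsilon> \<le> 1" using norm_ge_zero[of x] by linarith
      then have "x \<in> C" "y \<in> C" using x xy(2) by (auto simp: C_def)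
      then have "leaf w z \<in> P" using xy(1) by (auto simp: P_def)
      then have "symmetrize z w \<in> K ` P"
        using KF[of "symmetrize z w"] z w by (metis image_eqI leaf_def symmetrize_in_sym_bidisc_iff)
      then have "w \<in> W" using w by (simp add: W_def)
      then show False using \<rho>(2) l by fastforce
    qed
  qed
qed

text \<open>As a function of the parameter \<open>w\<close> the product is holomorphic, and by the boundary estimate and properness it tends to 0 at the circle.\<close>

lemma discrim_mult_leaf_form_eq_0:
  assumes z: "z \<in> \<bbbD>" and w: "w \<in> \<bbbD>"
  shows "discrim (leaf w z) * leaf_form (leaf w z) (leaf_velocity w z) = 0"
proof -
  let ?u = "\<lambda>w. discrim (leaf w z) * leaf_form (leaf w z) (leaf_velocity w z)"
  have 1: "(\<lambda>w. leaf w z $ i) holomorphic_on \<bbbD>" for i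
    unfolding leaf_commute[of _ z] by (rule leaf_holomorphic[OF z])
  show ?thesis
  proof (rule holomorphic_zero_if_zero_boundary[of ?u, OF _ _ w])
    show "?u holomorphic_on \<bbbD>"
      unfolding discrim_def leaf_form_def
      by (intro holomorphic_intros 1 leaf_velocity_holomorphic_parameter z)
    fix \<epsilon> :: real assume \<epsilon>: "\<epsilon> > 0"
    define \<delta> where "\<delta> = (1 - (cmod z)\<^sup>2)\<^sup>2"
    have \<delta>: "\<delta> > 0" using z abs_square_less_1[of "cmod z"] by (auto simp: \<delta>_def)
    have "\<epsilon> * \<delta> / 114 > 0" using \<epsilon> \<delta> by simp
    from leaf_proper[OF z this] obtain \<rho> where \<rho>: "\<rho> < 1"
      and b: "\<And>w x y. w \<in> \<bbbD> \<Longrightarrow> \<rho> < cmod w \<Longrightarrow> leaf w z = symmetrize x y \<Longrightarrow> cmod y \<le> cmod x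
        \<Longrightarrow> 1 - \<epsilon> * \<delta> / 114 < cmod x"
      by blast
    show "\<exists>\<rho><1. \<forall>w\<in>\<bbbD>. \<rho> < cmod w \<longrightarrow> cmod (?u w) \<le> \<epsilon>"
    proof (intro exI[of _ \<rho>] conjI ballI impI \<rho>)
      fix w assume w: "w \<in> \<bbbD>" and l: "\<rho> < cmod w"
      obtain x y where "leaf w z = symmetrize x y" by (rule symmetrize_surj)
      then obtain x y where xy: "leaf w z = symmetrize x y" "cmod y \<le> cmod x"
        using symmetrize_commute linear by metis
      have "cmod (?u w) * \<delta> \<le> 114 * (1 - cmod x)"
        unfolding \<delta>_def by (rule leaf_form_boundary_estimate[OF leaf_disc[OF w] z xy])
      also have "\<dots> \<le> \<epsilon> * \<delta>" using b[OF w l xy] by simp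
      finally show "cmod (?u w) \<le> \<epsilon>" using \<delta> by simp
    qed
  qed
qed

text \<open>If the form is nonzero at one point, it is nonzero for all nearby \<open>z\<close>, and for each of these the discriminant vanishes
  for all \<open>w\<close>. By analytic continuation in \<open>z\<close> it vanishes identically, so that \<open>F\<close> maps into the royal variety and is not onto.\<close>

lemma leaf_form_leaf_velocity_eq_0:
  assumes z0: "z \<in> \<bbbD>" and w0: "w \<in> \<bbbD>"
  shows "leaf_form (leaf w z) (leaf_velocity w z) = 0"
proof (rule ccontr)
  assume n: "\<not> ?thesis"
  let ?Q = "\<lambda>z. leaf_form (leaf w z) (leaf_velocity w z)"
  define U where "U = \<bbbD> \<inter> ?Q -` (- {0})"
  have "?Q holomorphic_on \<bbbD>"
    unfolding leaf_form_def by (intro holomorphic_intros leaf_holomorphic leaf_velocity_holomorphic w0)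
  then have U: "open U"
    unfolding U_def by (intro continuous_open_preimage holomorphic_on_imp_continuous_on) auto
  have ne: "U \<noteq> {}" using n z0 by (auto simp: U_def)
  have d0: "discrim (leaf v u) = 0" if u: "u \<in> U" and v: "v \<in> \<bbbD>" for u v
  proof -
    have uD: "u \<in> \<bbbD>" using u by (simp add: U_def)
    have 1: "(\<lambda>w. leaf w u $ i) holomorphic_on \<bbbD>" for i
      unfolding leaf_commute[of _ u] by (rule leaf_holomorphic[OF uD])
    have "(\<forall>v\<in>\<bbbD>. discrim (leaf v u) = 0) \<or> (\<forall>v\<in>\<bbbD>. leaf_form (leaf v u) (leaf_velocity v u) = 0)"
    proof (rule holomorphic_mult_eq_0)
      show "(\<lambda>v. discrim (leaf v u)) holomorphic_on \<bbbD>"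
        unfolding discrim_def by (intro holomorphic_intros 1)
      show "(\<lambda>v. leaf_form (leaf v u) (leaf_velocity v u)) holomorphic_on \<bbbD>"
        unfolding leaf_form_def by (intro holomorphic_intros 1 leaf_velocity_holomorphic_parameter uD)
    qed (rule discrim_mult_leaf_form_eq_0[OF uD])
    then show ?thesis using u v w0 by (auto simp: U_def)
  qed
  have d1: "discrim (leaf v u) = 0" if u: "u \<in> \<bbbD>" and v: "v \<in> \<bbbD>" for u v
  proof (rule analytic_continuation_open[OF U _ ne, of \<bbbD> "\<lambda>u. discrim (leaf v u)" "\<lambda>_. 0"])
    show "(\<lambda>u. discrim (leaf v u)) holomorphic_on \<bbbD>"
      unfolding discrim_def by (intro holomorphic_intros leaf_holomorphic v)
  qed (use u v d0 in \<open>auto simp: U_def\<close>)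
  define q where "q = symmetrize 0 (1/2)"
  have q: "q \<in> sym_bidisc" by (simp add: q_def symmetrize_in_sym_bidisc_iff)
  obtain u v where uv: "u \<in> \<bbbD>" "v \<in> \<bbbD>" "K q = symmetrize u v"
    using K_in[OF q] by (rule sym_bidisc_cases)
  then have "leaf v u = q" using FK[OF q] by (simp add: leaf_def)
  then have "discrim q = 0" using d1[OF uv(1,2)] by simp
  then show False by (simp add: q_def discrim_symmetrize)
qed

text \<open>The differential of \<open>K\<close> at the image point recovers the directions of both leaves, so the velocities of their images remain independent.\<close>

lemma inverse_differential:
  assumes z: "z \<in> \<bbbD>" and w: "w \<in> \<bbbD>"
  shows "\<exists>L :: complex^2 \<Rightarrow> complex^2. complex_linear L \<and> L (leaf_velocity w z) = vector [1, w]
    \<and> L (leaf_velocity z w) = vector [1, z]"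
proof -
  obtain L where L: "complex_linear L"
    "\<forall>h z' v. h z' = leaf w z \<longrightarrow> has_curve_derivative h v z'
       \<longrightarrow> has_curve_derivative (\<lambda>\<zeta>. K (h \<zeta>)) (L v) z'"
    using holomorphic_map_on_differential[OF K_hol leaf_in[OF z w]] by blast
  have *: "L (leaf_velocity b a) = vector [1, b]" if ab: "a \<in> \<bbbD>" "b \<in> \<bbbD>" "leaf b a = leaf w z" for a b
  proof -
    have KL: "has_curve_derivative (\<lambda>\<zeta>. K (leaf b \<zeta>)) (L (leaf_velocity b a)) a"
      using L(2) ab(3) leaf_has_curve_derivative[OF ab(1,2)] by blast
    have "has_curve_derivative (\<lambda>\<zeta>. symmetrize \<zeta> b) (L (leaf_velocity b a)) a"
      unfolding has_curve_derivative_def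
    proof
      fix i
      show "((\<lambda>\<zeta>. symmetrize \<zeta> b $ i) has_field_derivative L (leaf_velocity b a) $ i) (at a)"
        by (rule has_field_derivative_transform_within_open
              [OF has_curve_derivative_nth[OF KL] open_ball[of 0 1] ab(1)])
           (use ab(2) in \<open>simp add: leaf_def KF symmetrize_in_sym_bidisc_iff\<close>)
    qed
    then show ?thesis
      using has_curve_derivative_imp_curve_deriv symmetrize_has_curve_derivative by metis
  qed
  show ?thesis
    using L(1) *[OF z w refl] *[OF w z leaf_commute] by blast
qed

lemma leaf_velocity_fst_nonzero:
  assumes z: "z \<in> \<bbbD>" and w: "w \<in> \<bbbD>"
  shows "leaf_velocity w z $ 1 \<noteq> 0"
proof
  assume 0: "leaf_velocity w z $ 1 = 0"
  then have "leaf_velocity w z $ 2 = 0"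
    using leaf_form_leaf_velocity_eq_0[OF assms] by (simp add: leaf_form_def)
  with 0 have "leaf_velocity w z = 0" by (simp add: vec2_eq_iff)
  moreover obtain L :: "complex^2 \<Rightarrow> complex^2" where "complex_linear L" "L (leaf_velocity w z) = vector [1, w]"
    using inverse_differential[OF assms] by blast
  ultimately have "(vector [1, w] :: complex^2) = 0" by (simp add: complex_linear_0)
  then show False by (metis vector_2(1) zero_index zero_neq_one)
qed

text \<open>On the royal variety the form is a square and has a single null direction, whereas the images of the two leaves
  through a point off the royal variety supply two independent ones.\<close>

lemma leaf_not_royal:
  assumes z: "z \<in> \<bbbD>" and w: "w \<in> \<bbbD>" and ne: "z \<noteq> w"
  shows "leaf w z \<notin> royal"
proof
  assume "leaf w z \<in> royal"
  then obtain c where c: "leaf w z = symmetrize c c"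
    unfolding royal_def symmetrize_diagonal[symmetric] by blast
  let ?v = "leaf_velocity w z" and ?v' = "leaf_velocity z w"
  have v: "?v $ 2 = c * ?v $ 1" "?v' $ 2 = c * ?v' $ 1"
    using leaf_form_leaf_velocity_eq_0[OF z w] leaf_form_leaf_velocity_eq_0[OF w z]
    unfolding leaf_commute[of z w] c leaf_form_symmetrize by auto
  then have "?v' $ 1 *s ?v = ?v $ 1 *s ?v'" by (simp add: vec2_eq_iff)
  moreover obtain L :: "complex^2 \<Rightarrow> complex^2" where L: "complex_linear L" "L ?v = vector [1, w]" "L ?v' = vector [1, z]"
    using inverse_differential[OF z w] by blast
  ultimately have "?v' $ 1 *s vector [1, w] = ?v $ 1 *s (vector [1, z] :: complex^2)"
    using complex_linear_scale[OF L(1)] by metis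
  then have "?v' $ 1 = ?v $ 1 \<and> ?v' $ 1 * w = ?v $ 1 * z"
    by (auto simp only: vec2_eq_iff vector_smult_component vector_2 mult_1_right)
  then show False using leaf_velocity_fst_nonzero[OF z w] ne by (metis mult_cancel_left)
qed

text \<open>The action of \<open>F\<close> on the royal variety, parametrized by \<open>w \<mapsto> symmetrize w w\<close>.\<close>

definition diag :: "complex \<Rightarrow> complex"
  where "diag w = leaf w w $ 1 / 2"

lemma leaf_diagonal:
  assumes w: "w \<in> \<bbbD>" shows "leaf w w = symmetrize (diag w) (diag w)" "diag w \<in> \<bbbD>"
proof -
  interpret K: sym_bidisc_automorphism K F by (rule swap)
  obtain a b where ab: "a \<in> \<bbbD>" "b \<in> \<bbbD>" "leaf w w = symmetrize a b"
    using leaf_in[OF w w] by (rule sym_bidisc_cases)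
  have "K.leaf b a = symmetrize w w"
    unfolding K.leaf_def ab(3)[symmetric] leaf_def using w by (simp add: KF symmetrize_in_sym_bidisc_iff)
  then have "a = b" using K.leaf_not_royal[OF ab(1,2)] w by (auto simp: symmetrize_in_royal_iff)
  then show "leaf w w = symmetrize (diag w) (diag w)" "diag w \<in> \<bbbD>"
    using ab by (auto simp: diag_def)
qed

text \<open>The slope \<open>X\<close> of the pushed forward leaf is a root of \<open>X\<^sup>2 - s X + p\<close>. Differentiating this relation along the leaf, where
  \<open>p' = X s'\<close>, leaves \<open>(2 X - s) X' = 0\<close>. The first factor vanishes only on the royal variety, which the leaf meets only at
  \<open>z = w\<close>, so \<open>X\<close> is constant, and its value can be read off at \<open>z = w\<close>.\<close>

lemma leaf_in_leaf:
  assumes z: "z \<in> \<bbbD>" and w: "w \<in> \<bbbD>"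
  shows "(diag w)\<^sup>2 - leaf w z $ 1 * diag w + leaf w z $ 2 = 0"
proof -
  define X where "X z = leaf_velocity w z $ 2 / leaf_velocity w z $ 1" for z
  have nz: "leaf_velocity w z $ 1 \<noteq> 0" if "z \<in> \<bbbD>" for z
    by (rule leaf_velocity_fst_nonzero[OF that w])
  have X: "X holomorphic_on \<bbbD>"
    unfolding X_def by (intro holomorphic_intros leaf_velocity_holomorphic w nz)
  have X2: "leaf_velocity w z $ 2 = X z * leaf_velocity w z $ 1" if "z \<in> \<bbbD>" for z
    using nz[OF that] by (simp add: X_def)
  have root: "(X z)\<^sup>2 - leaf w z $ 1 * X z + leaf w z $ 2 = 0" if "z \<in> \<bbbD>" for z
  proof -
    have "(leaf_velocity w z $ 1)\<^sup>2 * ((X z)\<^sup>2 - leaf w z $ 1 * X z + leaf w z $ 2) = 0"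
      using leaf_form_leaf_velocity_eq_0[OF that w] unfolding leaf_form_def X2[OF that]
      by (simp add: algebra_simps power2_eq_square)
    then show ?thesis using nz[OF that] by simp
  qed
  have X'0: "deriv X z = 0" if zD: "z \<in> \<bbbD>" and ne: "z \<noteq> w" for z
  proof -
    have dX: "(X has_field_derivative deriv X z) (at z)" by (rule holomorphic_derivI[OF X _ zD]) simp
    have "((\<lambda>\<zeta>. (X \<zeta>)\<^sup>2 - leaf w \<zeta> $ 1 * X \<zeta> + leaf w \<zeta> $ 2) has_field_derivative
        (2 * X z - leaf w z $ 1) * deriv X z) (at z)"
      by (auto intro!: derivative_eq_intros dX leaf_has_derivative[OF zD w]
          simp: X2[OF zD] algebra_simps)
    moreover have "((\<lambda>\<zeta>. (X \<zeta>)\<^sup>2 - leaf w \<zeta> $ 1 * X \<zeta> + leaf w \<zeta> $ 2) has_field_derivative 0) (at z)"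
      by (rule has_field_derivative_transform_within_open[OF DERIV_const open_ball[of 0 1] zD])
         (simp add: root)
    ultimately have "(2 * X z - leaf w z $ 1) * deriv X z = 0" by (rule DERIV_unique)
    moreover have "2 * X z - leaf w z $ 1 \<noteq> 0"
    proof
      assume "2 * X z - leaf w z $ 1 = 0"
      then have s: "leaf w z $ 1 = 2 * X z" by simp
      then have "leaf w z $ 2 = X z * X z"
        using root[OF zD] by (simp add: power2_eq_square algebra_simps)
      with s have e: "leaf w z = symmetrize (X z) (X z)" by (simp add: vec2_eq_iff)
      have "leaf w z \<in> royal"
        using leaf_in[OF zD w] unfolding e symmetrize_in_royal_iff symmetrize_in_sym_bidisc_iff by simp
      then show False using leaf_not_royal[OF zD w ne] by simp
    qed
    ultimately show ?thesis by simp
  qed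
  have "deriv X z = 0" if "z \<in> \<bbbD>" for z
  proof (rule analytic_continuation_open[of "\<bbbD> - {w}" \<bbbD> "deriv X" "\<lambda>_. 0"])
    have "(if w = 0 then 1/2 else 0) \<in> \<bbbD> - {w}" by simp
    then show "\<bbbD> - {w} \<noteq> {}" by blast
    show "deriv X holomorphic_on \<bbbD>" by (rule holomorphic_deriv[OF X]) simp
  qed (use X'0 that in \<open>auto intro: open_Diff\<close>)
  then have "(X has_field_derivative 0) (at z within \<bbbD>)" if "z \<in> \<bbbD>" for z
    using holomorphic_derivI[OF X _ that, of \<bbbD>] that by (metis open_ball)
  then obtain c where c: "\<And>z. z \<in> \<bbbD> \<Longrightarrow> X z = c"
    using has_field_derivative_zero_constant[of \<bbbD> X] by auto
  have "(X w - diag w)\<^sup>2 = 0"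
    using root[OF w] unfolding leaf_diagonal(1)[OF w] by (simp add: power2_eq_square algebra_simps)
  then have "c = diag w" using c[OF w] by simp
  then show ?thesis using root[OF z] c[OF z] by (simp add: mult.commute)
qed

lemma diag_inj: "z \<in> \<bbbD> \<Longrightarrow> w \<in> \<bbbD> \<Longrightarrow> diag z = diag w \<Longrightarrow> z = w"
  using KF[of "symmetrize z z"] KF[of "symmetrize w w"] leaf_diagonal(1)[of z] leaf_diagonal(1)[of w]
  by (auto simp: leaf_def symmetrize_in_sym_bidisc_iff symmetrize_eq_iff)

text \<open>By \<open>leaf_in_leaf\<close>, applied to the two leaves through the point, both \<open>diag z\<close> and \<open>diag w\<close> are among the two roots of the image.\<close>

lemma automorphism_symmetrize:
  assumes z: "z \<in> \<bbbD>" and w: "w \<in> \<bbbD>"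
  shows "F (symmetrize z w) = symmetrize (diag z) (diag w)"
proof (cases "z = w")
  case True
  then show ?thesis using leaf_diagonal(1)[OF w] by (simp add: leaf_def)
next
  case False
  then have ne: "diag z \<noteq> diag w" using diag_inj[OF z w] by blast
  obtain a b where ab: "leaf w z = symmetrize a b" by (rule symmetrize_surj)
  have "(diag w - a) * (diag w - b) = 0" "(diag z - a) * (diag z - b) = 0"
    using leaf_in_leaf[OF z w] leaf_in_leaf[OF w z] unfolding leaf_commute[of z w] ab
    by (simp_all add: algebra_simps power2_eq_square)
  then have "symmetrize a b = symmetrize (diag z) (diag w)"
    using ne by (auto simp: symmetrize_eq_iff)
  then show ?thesis using ab by (simp add: leaf_def)
qed

text \<open>\<open>diag w + diag 0\<close> is the first coordinate of the leaf with parameter 0, so holomorphy of the restriction to the diagonal comes for free.\<close>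

lemma diag_holomorphic: "diag holomorphic_on \<bbbD>"
proof -
  have "(\<lambda>w. leaf 0 w $ 1 - diag 0) holomorphic_on \<bbbD>"
    by (intro holomorphic_intros leaf_holomorphic) simp
  then show ?thesis
    by (rule holomorphic_transform) (simp add: leaf_def automorphism_symmetrize)
qed

text \<open>Schwarz--Pick for the disc map \<open>diag\<close> and for its inverse.\<close>

lemma pseudohyperbolic_diag:
  assumes z: "z \<in> \<bbbD>" and w: "w \<in> \<bbbD>"
  shows "cmod (Moebius_function 0 (diag w) (diag z)) = cmod (Moebius_function 0 w z)"
proof -
  interpret K: sym_bidisc_automorphism K F by (rule swap)
  have inv: "K.diag (diag u) = u" if u: "u \<in> \<bbbD>" for u
  proof -
    have "symmetrize (K.diag (diag u)) (K.diag (diag u)) = symmetrize u u"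
      using K.leaf_diagonal(1)[OF leaf_diagonal(2)[OF u]] leaf_diagonal(1)[OF u] KF[of "symmetrize u u"] u
      by (simp add: leaf_def K.leaf_def symmetrize_in_sym_bidisc_iff)
    then show ?thesis by (auto simp: symmetrize_eq_iff)
  qed
  have "diag ` \<bbbD> \<subseteq> \<bbbD>" "K.diag ` \<bbbD> \<subseteq> \<bbbD>" using leaf_diagonal(2) K.leaf_diagonal(2) by blast+
  then show ?thesis
    using schwarz_pick[OF diag_holomorphic _ w z]
      schwarz_pick[OF K.diag_holomorphic _ leaf_diagonal(2)[OF w] leaf_diagonal(2)[OF z]]
    unfolding inv[OF z] inv[OF w] by (metis order.antisym)
qed

end

lemma Aut_imp_sym_bidisc_automorphism:
  assumes "F \<in> Aut sym_bidisc"
  shows "sym_bidisc_automorphism F (the_inv_into sym_bidisc F)"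
proof -
  have bij: "bij_betw F sym_bidisc sym_bidisc" using assms by (simp add: Aut_def)
  then have inj: "inj_on F sym_bidisc" and im: "F ` sym_bidisc = sym_bidisc"
    by (auto simp: bij_betw_def)
  show ?thesis
  proof
    fix x :: "complex^2" assume x: "x \<in> sym_bidisc"
    show "F x \<in> sym_bidisc" using x im by blast
    show "the_inv_into sym_bidisc F x \<in> sym_bidisc" using x im inj by (metis the_inv_into_into order_refl)
    show "the_inv_into sym_bidisc F (F x) = x" using x inj by (rule the_inv_into_f_f[rotated])
    show "F (the_inv_into sym_bidisc F x) = x" using x im inj by (metis f_the_inv_into_f)
  qed (use assms in \<open>simp_all add: Aut_def\<close>)
qed

section \<open>Orbits\<close>

text \<open>The map induced on \<open>(z + w, z w)\<close> by applying \<open>Moebius_function 0 a\<close> to both \<open>z\<close> and \<open>w\<close>.\<close>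

definition sym_moebius :: "complex \<Rightarrow> complex^2 \<Rightarrow> complex^2"
  where "sym_moebius a x = (\<chi> i.
    (if i = 1 then (1 + a * cnj a) * x $ 1 - 2 * cnj a * x $ 2 - 2 * a else x $ 2 - a * x $ 1 + a\<^sup>2)
      / (1 - cnj a * x $ 1 + (cnj a)\<^sup>2 * x $ 2))"

lemma moebius_denominator:
  assumes "cmod a < 1" "cmod z < 1"
  shows "1 - cnj a * z \<noteq> 0"
proof
  assume "1 - cnj a * z = 0"
  then have "cmod (cnj a * z) = 1" by (metis eq_iff_diff_eq_0 norm_one)
  then show False using assms mult_strict_mono[of "cmod a" 1 "cmod z" 1] by (simp add: norm_mult)
qed

lemma sym_moebius_symmetrize:
  assumes "cmod a < 1" "z \<in> \<bbbD>" "w \<in> \<bbbD>"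
  shows "sym_moebius a (symmetrize z w) = symmetrize (Moebius_function 0 a z) (Moebius_function 0 a w)"
proof -
  have nz: "1 - cnj a * z \<noteq> 0" "1 - cnj a * w \<noteq> 0"
    using assms moebius_denominator[of a z] moebius_denominator[of a w] by simp_all
  have d: "1 - cnj a * (z + w) + (cnj a)\<^sup>2 * (z * w) = (1 - cnj a * z) * (1 - cnj a * w)"
    by (simp add: algebra_simps power2_eq_square)
  have s: "(z - a) / (1 - cnj a * z) + (w - a) / (1 - cnj a * w)
      = ((1 + a * cnj a) * (z + w) - 2 * cnj a * (z * w) - 2 * a) / ((1 - cnj a * z) * (1 - cnj a * w))"
    using nz by (simp add: add_frac_eq) (simp add: algebra_simps)
  have p: "(z - a) / (1 - cnj a * z) * ((w - a) / (1 - cnj a * w))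
      = (z * w - a * (z + w) + a\<^sup>2) / ((1 - cnj a * z) * (1 - cnj a * w))"
    by (simp add: algebra_simps power2_eq_square)
  show ?thesis
    unfolding vec2_eq_iff symmetrize_nth Moebius_function_simple s p
    by (simp add: sym_moebius_def d)
qed

lemma sym_moebius_in:
  assumes "cmod a < 1" "x \<in> sym_bidisc"
  shows "sym_moebius a x \<in> sym_bidisc"
  using assms(2)
  by (rule sym_bidisc_cases)
     (use assms(1) in \<open>simp add: sym_moebius_symmetrize symmetrize_in_sym_bidisc_iff Moebius_function_norm_lt_1\<close>)

lemma sym_moebius_inverse:
  assumes "cmod a < 1" "x \<in> sym_bidisc"
  shows "sym_moebius (- a) (sym_moebius a x) = x"
  using assms(2)
proof (rule sym_bidisc_cases)
  fix z w assume "z \<in> \<bbbD>" "w \<in> \<bbbD>" "x = symmetrize z w"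
  then show ?thesis
    using assms(1) by (simp add: sym_moebius_symmetrize Moebius_function_norm_lt_1 Moebius_function_compose)
qed

lemma sym_moebius_holomorphic:
  assumes "cmod a < 1"
  shows "holomorphic_map_on (sym_moebius a) sym_bidisc"
  unfolding holomorphic_map_on_def
proof
  fix i :: 2
  have "1 - cnj a * x $ 1 + (cnj a)\<^sup>2 * x $ 2 \<noteq> 0" if "x \<in> sym_bidisc" for x :: "complex^2"
    using that
  proof (rule sym_bidisc_cases)
    fix z w assume zw: "z \<in> \<bbbD>" "w \<in> \<bbbD>" "x = symmetrize z w"
    have "1 - cnj a * (z + w) + (cnj a)\<^sup>2 * (z * w) = (1 - cnj a * z) * (1 - cnj a * w)"
      by (simp add: algebra_simps power2_eq_square)
    then show ?thesis
      using zw assms moebius_denominator[of a z] moebius_denominator[of a w] by simp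
  qed
  moreover have "i = 1 \<or> i = 2" by (rule exhaust_2)
  ultimately show "holomorphic_fun_on (\<lambda>x. sym_moebius a x $ i) sym_bidisc"
    unfolding sym_moebius_def by (auto intro!: hol_fun_intros)
qed

lemma sym_moebius_Aut:
  assumes a: "cmod a < 1"
  shows "sym_moebius a \<in> Aut sym_bidisc"
proof -
  have a': "cmod (- a) < 1" using a by simp
  have inv1: "sym_moebius (- a) (sym_moebius a x) = x" if "x \<in> sym_bidisc" for x
    by (rule sym_moebius_inverse[OF a that])
  have inv2: "sym_moebius a (sym_moebius (- a) x) = x" if "x \<in> sym_bidisc" for x
    using sym_moebius_inverse[OF a' that] by simp
  have bij: "bij_betw (sym_moebius a) sym_bidisc sym_bidisc"
    by (rule bij_betw_byWitness[of _ "sym_moebius (- a)"])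
       (use inv1 inv2 sym_moebius_in[OF a] sym_moebius_in[OF a'] in auto)
  have "the_inv_into sym_bidisc (sym_moebius a) x = sym_moebius (- a) x" if "x \<in> sym_bidisc" for x
    by (rule the_inv_into_f_eq[OF bij_betw_imp_inj_on[OF bij] inv2[OF that] sym_moebius_in[OF a' that]])
  then have "holomorphic_map_on (the_inv_into sym_bidisc (sym_moebius a)) sym_bidisc"
    using holomorphic_map_on_cong[OF sym_moebius_holomorphic[OF a'] open_sym_bidisc] by metis
  then show ?thesis
    using bij sym_moebius_holomorphic[OF a] by (simp add: Aut_def)
qed

lemma base_point_symmetrize: "base_point \<sigma> = symmetrize (of_real \<sigma>) (- of_real \<sigma>)"
  by (simp add: base_point_def symmetrize_def power2_eq_square)

lemma Orb_symmetrize_moebius: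
  assumes "cmod a < 1" "z \<in> \<bbbD>" "w \<in> \<bbbD>"
  shows "symmetrize (Moebius_function 0 a z) (Moebius_function 0 a w) \<in> Orb (symmetrize z w)"
  unfolding Orb_def using sym_moebius_Aut[OF assms(1)] sym_moebius_symmetrize[OF assms]
  by (metis (mono_tags, lifting) mem_Collect_eq)

lemma Orb_symmetrize_pseudohyperbolic:
  assumes "x \<in> Orb (symmetrize z w)" "z \<in> \<bbbD>" "w \<in> \<bbbD>"
  obtains a b where "a \<in> \<bbbD>" "b \<in> \<bbbD>" "x = symmetrize a b"
    "cmod (Moebius_function 0 b a) = cmod (Moebius_function 0 w z)"
proof -
  obtain F where F: "F \<in> Aut sym_bidisc" "x = F (symmetrize z w)"
    using assms(1) by (auto simp: Orb_def)
  interpret sym_bidisc_automorphism F "the_inv_into sym_bidisc F"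
    by (rule Aut_imp_sym_bidisc_automorphism[OF F(1)])
  show ?thesis
    using that[OF leaf_diagonal(2)[OF assms(2)] leaf_diagonal(2)[OF assms(3)]]
      automorphism_symmetrize[OF assms(2,3)] pseudohyperbolic_diag[OF assms(2,3)] F(2) by simp
qed

lemma polarization_identity:
  "2 * (cmod (1 - cnj b * a))\<^sup>2 = 2 + 2 * (cmod (a * b))\<^sup>2 - (cmod (a + b))\<^sup>2 + (cmod (a - b))\<^sup>2"
  by (simp add: cmod_power2) (simp add: power2_eq_square algebra_simps)

text \<open>The condition that the roots have the pseudohyperbolic distance of \<open>\<sigma>\<close> and \<open>- \<sigma>\<close>, rewritten in the coordinates \<open>s\<close> and \<open>p\<close>.\<close>

lemma Orb_base_point_equation:
  fixes x :: "complex^2"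
  assumes \<sigma>: "0 < \<sigma>" "\<sigma> < 1" and x: "x \<in> Orb (base_point \<sigma>)"
  shows "cmod ((x $ 1)\<^sup>2 - 4 * x $ 2) * (1 + \<sigma> ^ 4) = 2 * \<sigma>\<^sup>2 * (2 + 2 * (cmod (x $ 2))\<^sup>2 - (cmod (x $ 1))\<^sup>2)"
proof -
  have \<sigma>D: "of_real \<sigma> \<in> \<bbbD>" "- of_real \<sigma> \<in> \<bbbD>" using \<sigma> by auto
  obtain a b where ab: "a \<in> \<bbbD>" "b \<in> \<bbbD>" "x = symmetrize a b"
    and m: "cmod (Moebius_function 0 b a) = cmod (Moebius_function 0 (- of_real \<sigma>) (of_real \<sigma>))"
    using Orb_symmetrize_pseudohyperbolic[OF x[unfolded base_point_symmetrize] \<sigma>D] by blast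
  have "Moebius_function 0 (- of_real \<sigma>) (of_real \<sigma>) = of_real (2 * \<sigma> / (1 + \<sigma>\<^sup>2))"
    by (simp add: Moebius_function_simple power2_eq_square)
  then have m': "cmod (Moebius_function 0 b a) = 2 * \<sigma> / (1 + \<sigma>\<^sup>2)"
    using m \<sigma> by (simp only: norm_of_real) (simp add: abs_of_nonneg)
  have nz: "cmod (1 - cnj b * a) \<noteq> 0" "1 + \<sigma>\<^sup>2 \<noteq> 0"
    using moebius_denominator[of b a] ab add_pos_nonneg[of 1 "\<sigma>\<^sup>2"] by auto
  have "cmod (a - b) * (1 + \<sigma>\<^sup>2) = 2 * \<sigma> * cmod (1 - cnj b * a)"
    using m' nz by (simp add: Moebius_function_simple norm_divide field_simps)
  then have "(cmod (a - b) * (1 + \<sigma>\<^sup>2))\<^sup>2 = (2 * \<sigma> * cmod (1 - cnj b * a))\<^sup>2" by simp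
  then have "(cmod (a - b))\<^sup>2 * (1 + \<sigma>\<^sup>2)\<^sup>2 = 2 * \<sigma>\<^sup>2 * (2 * (cmod (1 - cnj b * a))\<^sup>2)"
    by (simp add: power_mult_distrib)
  then have "(cmod (a - b))\<^sup>2 * (1 + \<sigma> ^ 4) = 2 * \<sigma>\<^sup>2 * (2 + 2 * (cmod (a * b))\<^sup>2 - (cmod (a + b))\<^sup>2)"
    unfolding polarization_identity by (simp add: algebra_simps power2_eq_square power4_eq_xxxx)
  moreover have "cmod ((x $ 1)\<^sup>2 - 4 * x $ 2) = (cmod (a - b))\<^sup>2"
    using discrim_symmetrize[of a b] by (simp add: ab(3) discrim_def norm_power[symmetric])
  ultimately show ?thesis by (simp add: ab(3))
qed

text \<open>The squared orbit equation is polynomial in real coordinates. Differentiated at the base point, it only sees \<open>Re v\<^sub>2\<close>, with a coefficient that is nonzero because \<open>\<sigma> < 1\<close>.\<close>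

lemma real_tangent_space_Orb_base_point:
  fixes v :: "complex^2"
  assumes \<sigma>: "0 < \<sigma>" "\<sigma> < 1" and v: "v \<in> real_tangent_space (Orb (base_point \<sigma>)) (base_point \<sigma>)"
  shows "Re (v $ 2) = 0"
proof -
  obtain \<gamma> e where e: "0 < e" and im: "\<gamma> ` {-e<..<e} \<subseteq> Orb (base_point \<sigma>)" and \<gamma>0: "\<gamma> 0 = base_point \<sigma>"
    and der: "(\<gamma> has_vector_derivative v) (at 0)"
    using v unfolding real_tangent_space_def by blast
  have d: "((\<lambda>t. \<gamma> t $ i) has_derivative (\<lambda>t. t *\<^sub>R v $ i)) (at 0)" for i
    using bounded_linear.has_derivative[OF bounded_linear_vec_nth der[unfolded has_vector_derivative_def]]
    by simp
  define f where "f t = ((\<gamma> t $ 1)\<^sup>2 - 4 * \<gamma> t $ 2) \<bullet> ((\<gamma> t $ 1)\<^sup>2 - 4 * \<gamma> t $ 2) * (1 + \<sigma> ^ 4)\<^sup>2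
     - 4 * \<sigma> ^ 4 * (2 + 2 * (\<gamma> t $ 2 \<bullet> \<gamma> t $ 2) - \<gamma> t $ 1 \<bullet> \<gamma> t $ 1)\<^sup>2" for t
  have f0: "f t = 0" if "t \<in> {-e<..<e}" for t
  proof -
    have "\<gamma> t \<in> Orb (base_point \<sigma>)" using im that by blast
    from Orb_base_point_equation[OF \<sigma> this]
    have "(cmod ((\<gamma> t $ 1)\<^sup>2 - 4 * \<gamma> t $ 2) * (1 + \<sigma> ^ 4))\<^sup>2
      = (2 * \<sigma>\<^sup>2 * (2 + 2 * (cmod (\<gamma> t $ 2))\<^sup>2 - (cmod (\<gamma> t $ 1))\<^sup>2))\<^sup>2" by simp
    then show ?thesis
      by (simp add: f_def power_mult_distrib dot_square_norm)
  qed
  have \<gamma>0': "\<gamma> 0 $ 1 = 0" "\<gamma> 0 $ 2 = - of_real (\<sigma>\<^sup>2)"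
    by (simp_all add: \<gamma>0 base_point_def)
  have "(f has_derivative (\<lambda>t. - 32 * \<sigma>\<^sup>2 * (1 + \<sigma> ^ 4) * (1 - \<sigma> ^ 4) * Re (v $ 2) * t)) (at 0)"
    unfolding f_def
    apply (rule derivative_eq_intros d refl | simp)+
    apply (simp add: \<gamma>0' inner_complex_def fun_eq_iff)
    apply (simp add: algebra_simps power2_eq_square power4_eq_xxxx)
    done
  moreover have "(f has_derivative (\<lambda>t. 0)) (at 0)"
    by (rule has_derivative_transform_within_open[OF has_derivative_const open_greaterThanLessThan, of _ "-e" e])
       (use e f0 in auto)
  ultimately have "(\<lambda>t. - 32 * \<sigma>\<^sup>2 * (1 + \<sigma> ^ 4) * (1 - \<sigma> ^ 4) * Re (v $ 2) * t) = (\<lambda>t. 0)"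
    by (rule has_derivative_unique)
  from fun_cong[OF this, of 1] have "\<sigma>\<^sup>2 * (1 + \<sigma> ^ 4) * (1 - \<sigma> ^ 4) * Re (v $ 2) = 0" by simp
  moreover have "\<sigma> ^ 4 < 1" using \<sigma> by (intro power_less_one_iff[THEN iffD2]) auto
  moreover have "\<sigma> ^ 4 \<ge> 0" using \<sigma> by simp
  ultimately show ?thesis using \<sigma> by (auto simp: add_nonneg_eq_0_iff)
qed

lemma holomorphic_curve_C1:
  fixes h :: "complex \<Rightarrow> complex^'n"
  assumes h: "\<And>i. (\<lambda>z. h z $ i) holomorphic_on ball 0 r"
  shows "(\<lambda>t. h (of_real t)) C1_differentiable_on {-r<..<r}"
    and "t \<in> {-r<..<r} \<Longrightarrow> ((\<lambda>t. h (of_real t)) has_vector_derivative curve_deriv h (of_real t)) (at t)"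
proof -
  have der: "((\<lambda>t. h (of_real t)) has_vector_derivative curve_deriv h (of_real t)) (at t)"
    if t: "t \<in> {-r<..<r}" for t
  proof -
    have "(h has_derivative (\<lambda>c. c *s curve_deriv h (of_real t))) (at (of_real t))"
      by (rule has_curve_derivative_imp_has_derivative[OF has_curve_derivative_curve_deriv[OF h]])
         (use t in auto)
    from has_derivative_compose[OF has_derivative_of_real[OF has_derivative_ident] this]
    have "((\<lambda>t. h (of_real t)) has_derivative (\<lambda>x. of_real x *s curve_deriv h (of_real t))) (at t)" .
    moreover have "complex_of_real x *s v = x *\<^sub>R v" for x and v :: "complex^'n"
      by (simp add: vec_eq_iff scaleR_conv_of_real[where 'a = complex])
    ultimately show ?thesis by (simp add: has_vector_derivative_def)
  qed
  show "t \<in> {-r<..<r} \<Longrightarrow> ((\<lambda>t. h (of_real t)) has_vector_derivative curve_deriv h (of_real t)) (at t)"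
    by (rule der)
  have "continuous_on (ball 0 r) (\<lambda>z. curve_deriv h z)"
    unfolding curve_deriv_def
    by (intro continuous_on_vec_lambda holomorphic_on_imp_continuous_on holomorphic_deriv h) simp
  then have "continuous_on {-r<..<r} (\<lambda>t. curve_deriv h (of_real t))"
    by (rule continuous_on_compose2[OF _ continuous_on_of_real[OF continuous_on_id]]) auto
  then show "(\<lambda>t. h (of_real t)) C1_differentiable_on {-r<..<r}"
    unfolding C1_differentiable_on_def
    by (intro exI[of _ "\<lambda>t. curve_deriv h (of_real t)"] conjI ballI der)
qed

text \<open>The curve moves \<open>\<sigma>\<close> and \<open>- \<sigma>\<close> by the Moebius maps with parameter \<open>- a t\<close>. Their velocities are
  both \<open>a - cnj a \<sigma>\<^sup>2\<close>, so the product of the roots is stationary and the sum moves with velocity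
  \<open>2 (a - cnj a \<sigma>\<^sup>2)\<close>; the real-linear map \<open>a \<mapsto> 2 (a - cnj a \<sigma>\<^sup>2)\<close> is onto because \<open>\<sigma> < 1\<close>.\<close>

lemma horizontal_in_real_tangent_space:
  assumes \<sigma>: "0 < \<sigma>" "\<sigma> < 1"
  shows "vector [u, 0] \<in> real_tangent_space (Orb (base_point \<sigma>)) (base_point \<sigma>)"
proof -
  define s where "s = complex_of_real \<sigma>"
  have \<sigma>2: "\<sigma>\<^sup>2 < 1" using \<sigma> by (simp add: abs_square_less_1)
  define a where "a = Complex (Re u / (2 * (1 - \<sigma>\<^sup>2))) (Im u / (2 * (1 + \<sigma>\<^sup>2)))"
  have u: "2 * (a - cnj a * s\<^sup>2) = u"
  proof -
    have nz: "1 + \<sigma>\<^sup>2 \<noteq> 0" "1 - \<sigma>\<^sup>2 \<noteq> 0"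
      using \<sigma>2 zero_le_power2[of \<sigma>] by linarith+
    have "2 * (a - cnj a * s\<^sup>2) = Complex (2 * (1 - \<sigma>\<^sup>2) * Re a) (2 * (1 + \<sigma>\<^sup>2) * Im a)"
      by (simp add: complex_eq_iff s_def algebra_simps power2_eq_square)
    also have "2 * (1 - \<sigma>\<^sup>2) * Re a = Re u" using nz by (simp add: a_def del: distrib_left right_diff_distrib)
    also have "2 * (1 + \<sigma>\<^sup>2) * Im a = Im u" using nz by (simp add: a_def del: distrib_left right_diff_distrib)
    finally show ?thesis by simp
  qed
  define r where "r = 1 / (1 + cmod a)"
  have r: "0 < r" by (simp add: r_def add_pos_nonneg)
  have ar: "cmod (a * z) < 1" if "cmod z < r" for z
  proof -
    have "cmod a * cmod z \<le> cmod a * r" using that by (intro mult_left_mono) auto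
    also have "\<dots> < 1" by (simp add: r_def divide_less_eq add_pos_nonneg)
    finally show ?thesis by (simp add: norm_mult)
  qed
  define h :: "complex \<Rightarrow> complex^2" where "h z = (\<chi> i. (if i = 1 then u * z else a\<^sup>2 * z\<^sup>2 - s\<^sup>2) / (1 - (cnj a * s * z)\<^sup>2))" for z
  have nz: "1 - (cnj a * s * z)\<^sup>2 \<noteq> 0" if "z \<in> ball 0 r" for z
  proof -
    have "cmod (cnj a * s * z) = cmod (a * z) * \<sigma>" using \<sigma> by (simp add: norm_mult s_def)
    also have "\<dots> < 1" using ar[of z] that \<sigma> mult_strict_mono[of "cmod (a * z)" 1 \<sigma> 1] by simp
    finally have "(cmod (cnj a * s * z))\<^sup>2 < 1" by (simp add: abs_square_less_1)
    then have "cmod ((cnj a * s * z)\<^sup>2) < 1" by (simp only: norm_power)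
    then show ?thesis by (metis eq_iff_diff_eq_0 less_irrefl norm_one)
  qed
  have hol: "(\<lambda>z. h z $ i) holomorphic_on ball 0 r" for i
  proof (cases "i = 1")
    case True
    then have "(\<lambda>z. h z $ i) = (\<lambda>z. u * z / (1 - (cnj a * s * z)\<^sup>2))" by (simp add: h_def)
    then show ?thesis by (simp only:) (intro holomorphic_intros nz)
  next
    case False
    then have "(\<lambda>z. h z $ i) = (\<lambda>z. (a\<^sup>2 * z\<^sup>2 - s\<^sup>2) / (1 - (cnj a * s * z)\<^sup>2))" by (simp add: h_def)
    then show ?thesis by (simp only:) (intro holomorphic_intros nz)
  qed
  have "has_curve_derivative h (vector [u, 0]) 0"
    unfolding has_curve_derivative_def forall_2 h_def by (auto intro!: derivative_eq_intros)
  then have d0: "curve_deriv h 0 = vector [u, 0]" by (rule has_curve_derivative_imp_curve_deriv)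
  have orb: "h (of_real t) \<in> Orb (base_point \<sigma>)" if t: "t \<in> {-r<..<r}" for t
  proof -
    let ?c = "a * of_real t"
    have c: "cmod (- ?c) < 1" using ar[of "of_real t"] t by auto
    have sD: "s \<in> \<bbbD>" "- s \<in> \<bbbD>" using \<sigma> by (auto simp: s_def)
    have nz2: "1 + cnj ?c * s \<noteq> 0" "1 - cnj ?c * s \<noteq> 0"
      using moebius_denominator[OF c, of s] moebius_denominator[OF c, of "- s"] sD by auto
    have "1 - (cnj a * s * of_real t)\<^sup>2 = (1 + cnj ?c * s) * (1 - cnj ?c * s)"
      by (simp add: algebra_simps power2_eq_square)
    moreover have "u * of_real t / ((1 + cnj ?c * s) * (1 - cnj ?c * s))
        = (s + ?c) / (1 + cnj ?c * s) + (- s + ?c) / (1 - cnj ?c * s)"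
      using nz2 unfolding u[symmetric] by (simp add: add_frac_eq) (simp add: algebra_simps power2_eq_square)
    moreover have "(a\<^sup>2 * (of_real t)\<^sup>2 - s\<^sup>2) / ((1 + cnj ?c * s) * (1 - cnj ?c * s))
        = (s + ?c) / (1 + cnj ?c * s) * ((- s + ?c) / (1 - cnj ?c * s))"
      by (simp add: algebra_simps power2_eq_square)
    ultimately have "h (of_real t) = symmetrize (Moebius_function 0 (- ?c) s) (Moebius_function 0 (- ?c) (- s))"
      unfolding vec2_eq_iff symmetrize_nth Moebius_function_simple by (simp add: h_def)
    also have "\<dots> \<in> Orb (base_point \<sigma>)"
      unfolding base_point_symmetrize s_def[symmetric] by (rule Orb_symmetrize_moebius[OF c sD])
    finally show ?thesis .
  qed
  have "h (of_real 0) = base_point \<sigma>"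
    by (simp add: vec2_eq_iff h_def base_point_def s_def)
  moreover have "((\<lambda>t. h (of_real t)) has_vector_derivative vector [u, 0]) (at 0)"
    using holomorphic_curve_C1(2)[OF hol, of 0] r d0 by simp
  ultimately show ?thesis
    unfolding real_tangent_space_def mem_Collect_eq
    using holomorphic_curve_C1(1)[OF hol] orb r by (intro exI[of _ "\<lambda>t. h (of_real t)"] exI[of _ r]) auto
qed

text \<open>A complex line contains with \<open>v\<close> also \<open>\<i> v\<close>, so \<open>Re v\<^sub>2 = 0\<close> on the line forces \<open>v\<^sub>2 = 0\<close>.\<close>

lemma sharp_base_point:
  assumes \<sigma>: "0 < \<sigma>" "\<sigma> < 1"
  shows "sharp (base_point \<sigma>) = vec.span {vector [1, 0]}"
proof -
  let ?e = "vector [1, 0] :: complex^2"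
  have e0: "?e \<noteq> 0" by (metis vector_2(1) zero_index zero_neq_one)
  have span: "vec.span {?e} = {vector [u, 0] | u. True}"
    unfolding vec.span_singleton by (auto simp: vec2_eq_iff)
  have dim: "vec.dim (vec.span {?e}) = 1"
    using e0 by (simp add: vec.dim_eq_card_independent)
  show ?thesis
    unfolding sharp_def
  proof (rule the_equality)
    show "vec.subspace (vec.span {?e}) \<and> vec.dim (vec.span {?e}) = 1 \<and>
      vec.span {?e} \<subseteq> real_tangent_space (Orb (base_point \<sigma>)) (base_point \<sigma>)"
      using horizontal_in_real_tangent_space[OF \<sigma>]
      by (intro conjI vec.subspace_span dim) (auto simp: span)
    fix V assume V: "vec.subspace V \<and> vec.dim V = 1 \<and>
      V \<subseteq> real_tangent_space (Orb (base_point \<sigma>)) (base_point \<sigma>)"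
    have "V \<subseteq> vec.span {?e}"
    proof
      fix v assume v: "v \<in> V"
      then have "\<i> *s v \<in> V" using V vec.subspace_scale by blast
      with v have "Re (v $ 2) = 0" "Re ((\<i> *s v) $ 2) = 0"
        using V real_tangent_space_Orb_base_point[OF \<sigma>] by blast+
      then have "v $ 2 = 0" by (simp add: complex_eq_iff)
      then have "v = vector [v $ 1, 0]" by (simp add: vec2_eq_iff)
      then show "v \<in> vec.span {?e}" unfolding span by blast
    qed
    then show "V = vec.span {?e}"
      using V dim vec.subspace_dim_equal[of V "vec.span {?e}"] vec.subspace_span by auto
  qed
qed

section \<open>Tangent lines of geodesics\<close>

text \<open>The left inverse \<open>g\<close> of \<open>k\<close> provides the change of variable: \<open>h = k \<circ> (g \<circ> h)\<close>, and the chain rule applies.\<close>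

lemma geodesic_map_reparametrize:
  assumes h: "geodesic_map h" and k: "geodesic_map k" and im: "h ` \<bbbD> \<subseteq> k ` \<bbbD>"
    and z: "z \<in> \<bbbD>" and w: "w \<in> \<bbbD>" and hk: "h z = k w"
  shows "\<exists>c. curve_deriv h z = c *s curve_deriv k w"
proof -
  have hd: "has_curve_derivative h (curve_deriv h z) z"
    by (rule has_curve_derivative_curve_deriv[of h \<bbbD>]) (use h z in \<open>auto simp: geodesic_map_def\<close>)
  have kd: "has_curve_derivative k (curve_deriv k w) w"
    by (rule has_curve_derivative_curve_deriv[of k \<bbbD>]) (use k w in \<open>auto simp: geodesic_map_def\<close>)
  obtain g where g: "holomorphic_fun_on g sym_bidisc" "\<And>z. z \<in> \<bbbD> \<Longrightarrow> g (k z) = z"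
    using k by (auto simp: geodesic_map_def)
  have hz: "h z \<in> sym_bidisc" using h z by (auto simp: geodesic_map_def)
  obtain c where c: "((\<lambda>\<zeta>. g (h \<zeta>)) has_field_derivative c) (at z)"
    using holomorphic_fun_on_along_curve[OF g(1) hz hd] by blast
  have gh: "g (h z) = w" using g(2)[OF w] hk by simp
  have kgh: "k (g (h \<zeta>)) = h \<zeta>" if "\<zeta> \<in> \<bbbD>" for \<zeta>
  proof -
    obtain u where "u \<in> \<bbbD>" "h \<zeta> = k u" using im \<open>\<zeta> \<in> \<bbbD>\<close> by blast
    then show ?thesis using g(2) by simp
  qed
  have "has_curve_derivative h (c *s curve_deriv k w) z"
    unfolding has_curve_derivative_def
  proof
    fix i
    have "((\<lambda>\<zeta>. k (g (h \<zeta>)) $ i) has_field_derivative curve_deriv k w $ i * c) (at z)"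
      by (rule DERIV_chain2[OF _ c]) (use has_curve_derivative_nth[OF kd] gh in simp)
    then have "((\<lambda>\<zeta>. h \<zeta> $ i) has_field_derivative curve_deriv k w $ i * c) (at z)"
      by (rule has_field_derivative_transform_within_open[OF _ open_ball[of 0 1] z]) (simp add: kgh)
    then show "((\<lambda>\<zeta>. h \<zeta> $ i) has_field_derivative (c *s curve_deriv k w) $ i) (at z)"
      by (simp add: mult.commute)
  qed
  then show ?thesis using has_curve_derivative_imp_curve_deriv by blast
qed

lemma geodesic_tangent_eq:
  assumes h: "geodesic_map h" and z: "z \<in> \<bbbD>"
  shows "geodesic_tangent (h ` \<bbbD>) (h z) = vec.span {curve_deriv h z}"
  unfolding geodesic_tangent_def
proof (rule the_equality)
  show "\<exists>h' z'. geodesic_map h' \<and> h ` \<bbbD> = h' ` \<bbbD> \<and> z' \<in> \<bbbD> \<and> h z = h' z' \<and>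
    vec.span {curve_deriv h z} = vec.span {curve_deriv h' z'}"
    using assms by blast
  fix V assume "\<exists>h' z'. geodesic_map h' \<and> h ` \<bbbD> = h' ` \<bbbD> \<and> z' \<in> \<bbbD> \<and> h z = h' z' \<and>
    V = vec.span {curve_deriv h' z'}"
  then obtain k w where k: "geodesic_map k" "h ` \<bbbD> = k ` \<bbbD>" "w \<in> \<bbbD>" "h z = k w"
    and V: "V = vec.span {curve_deriv k w}" by blast
  obtain c where "curve_deriv h z = c *s curve_deriv k w"
    using geodesic_map_reparametrize[OF h k(1) _ z k(3,4)] k(2) by blast
  moreover obtain d where "curve_deriv k w = d *s curve_deriv h z"
    using geodesic_map_reparametrize[OF k(1) h _ k(3) z k(4)[symmetric]] k(2) by blast
  ultimately have "curve_deriv h z \<in> vec.span {curve_deriv k w}" "curve_deriv k w \<in> vec.span {curve_deriv h z}"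
    by (metis vec.span_base vec.span_scale singletonI)+
  then show "V = vec.span {curve_deriv h z}"
    unfolding V by (intro equalityI vec.span_minimal vec.subspace_span) auto
qed

section \<open>The arc of parameters\<close>

text \<open>The condition squares to \<open>(2 - 2 Re \<tau>) = k\<^sup>2 (2 + 2 Re \<tau>)\<close>. At \<open>\<tau> = - 1\<close> the quotient is \<open>x / 0 = 0\<close>, which differs from \<open>k\<close>.\<close>

lemma tau_condition_iff:
  assumes k: "0 < k" and \<tau>: "cmod \<tau> = 1"
  shows "cmod ((\<tau> - 1) / (\<tau> + 1)) = k \<longleftrightarrow> Re \<tau> = (1 - k\<^sup>2) / (1 + k\<^sup>2)"
proof -
  have n: "(Re \<tau>)\<^sup>2 + (Im \<tau>)\<^sup>2 = 1" using \<tau> by (simp add: cmod_power2[symmetric])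
  have m: "(cmod (\<tau> - 1))\<^sup>2 = 2 - 2 * Re \<tau>" "(cmod (\<tau> + 1))\<^sup>2 = 2 + 2 * Re \<tau>"
    using n by (simp_all add: cmod_power2) (simp_all add: power2_eq_square algebra_simps)
  have k1: "1 + k\<^sup>2 > 0" by (simp add: add_pos_nonneg)
  show ?thesis
  proof (cases "\<tau> = - 1")
    case True
    have "(1 - k\<^sup>2) / (1 + k\<^sup>2) \<noteq> - 1" using k1 by (simp add: divide_eq_eq)
    then show ?thesis using True k by simp
  next
    case False
    then have pos: "0 < (cmod (\<tau> + 1))\<^sup>2" by (simp add: eq_neg_iff_add_eq_0)
    have "cmod ((\<tau> - 1) / (\<tau> + 1)) = k \<longleftrightarrow> (cmod ((\<tau> - 1) / (\<tau> + 1)))\<^sup>2 = k\<^sup>2"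
      using k by simp
    also have "\<dots> \<longleftrightarrow> (cmod (\<tau> - 1))\<^sup>2 = k\<^sup>2 * (cmod (\<tau> + 1))\<^sup>2"
      using pos by (simp add: norm_divide power_divide divide_eq_eq)
    also have "\<dots> \<longleftrightarrow> Re \<tau> * (1 + k\<^sup>2) = 1 - k\<^sup>2"
      unfolding m by (auto simp: algebra_simps)
    also have "\<dots> \<longleftrightarrow> Re \<tau> = (1 - k\<^sup>2) / (1 + k\<^sup>2)"
      using k1 by (auto simp: eq_divide_eq)
    finally show ?thesis .
  qed
qed

lemma unit_circle_eqI:
  assumes "cmod z = 1" "cmod w = 1" "Re z = Re w" "0 < Im z * Im w"
  shows "z = w"
proof -
  have "(Im z)\<^sup>2 = (Im w)\<^sup>2"
    using assms(1-3) cmod_power2[of z] cmod_power2[of w] by simp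
  then have "Im z = Im w \<or> Im z = - Im w" by (simp add: power2_eq_iff)
  then show ?thesis using assms(3,4) by (auto simp: complex_eq_iff zero_less_mult_iff)
qed

text \<open>The end points of the arc are \<open>cis (- \<alpha>)\<close> and \<open>cis \<alpha>\<close>, so the arc consists of the points of the circle with real part greater than \<open>cos \<alpha>\<close>.\<close>

lemma open_arc_tau:
  assumes \<sigma>: "0 < \<sigma>" "\<sigma> < 1" and \<tau>: "\<tau> \<in> open_arc (tau_minus \<sigma>) (tau_plus \<sigma>)"
  shows "cmod \<tau> = 1" and "(1 - \<sigma>\<^sup>2)\<^sup>2 * (1 - Re \<tau>) < 4 * \<sigma>\<^sup>2 * (1 + Re \<tau>)"
proof -
  define k where "k = 2 * \<sigma> / (1 - \<sigma>\<^sup>2)"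
  have q: "0 < 1 - \<sigma>\<^sup>2" using \<sigma> by (simp add: abs_square_less_1)
  have k: "0 < k" using \<sigma> q by (simp add: k_def)
  define c where "c = (1 - k\<^sup>2) / (1 + k\<^sup>2)"
  have k1: "1 + k\<^sup>2 > 0" by (simp add: add_pos_nonneg)
  have c: "-1 < c" "c < 1" using k k1 by (auto simp: c_def less_divide_eq divide_less_eq)
  define \<alpha> where "\<alpha> = arccos c"
  have \<alpha>: "0 < \<alpha>" "\<alpha> < pi" "cos \<alpha> = c"
    using c arccos_lt_bounded[of c] by (auto simp: \<alpha>_def)
  have sin: "0 < sin \<alpha>" using \<alpha> by (simp add: sin_gt_zero)
  have cond: "cmod ((\<tau> - 1) / (\<tau> + 1)) = k \<longleftrightarrow> Re \<tau> = c" if "\<tau> \<in> \<bbbT>" for \<tau>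
    using tau_condition_iff[OF k, of \<tau>] that by (simp add: c_def)
  have plus: "tau_plus \<sigma> = cis \<alpha>"
    unfolding tau_plus_def k_def[symmetric]
  proof (rule the_equality)
    show "cis \<alpha> \<in> \<bbbT> \<and> cmod ((cis \<alpha> - 1) / (cis \<alpha> + 1)) = k \<and> 0 < Im (cis \<alpha>)"
      using cond[of "cis \<alpha>"] \<alpha> sin by simp
    fix \<tau> assume "\<tau> \<in> \<bbbT> \<and> cmod ((\<tau> - 1) / (\<tau> + 1)) = k \<and> 0 < Im \<tau>"
    then show "\<tau> = cis \<alpha>" using cond[of \<tau>] \<alpha> sin by (intro unit_circle_eqI) auto
  qed
  have minus: "tau_minus \<sigma> = cis (- \<alpha>)"
    unfolding tau_minus_def k_def[symmetric]
  proof (rule the_equality)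
    show "cis (- \<alpha>) \<in> \<bbbT> \<and> cmod ((cis (- \<alpha>) - 1) / (cis (- \<alpha>) + 1)) = k \<and> Im (cis (- \<alpha>)) < 0"
      using cond[of "cis (- \<alpha>)"] \<alpha> sin by simp
    fix \<tau> assume "\<tau> \<in> \<bbbT> \<and> cmod ((\<tau> - 1) / (\<tau> + 1)) = k \<and> Im \<tau> < 0"
    then show "\<tau> = cis (- \<alpha>)" using cond[of \<tau>] \<alpha> sin
      by (intro unit_circle_eqI) (auto simp: mult_neg_pos)
  qed
  have "cis \<alpha> / cis (- \<alpha>) = cis (2 * \<alpha>)" by (simp add: cis_divide)
  moreover have "Arg2pi (cis (2 * \<alpha>)) = 2 * \<alpha>"
    by (rule Arg2pi_unique[of 1]) (use \<alpha> in \<open>auto simp: cis_conv_exp\<close>)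
  ultimately obtain t where t: "0 < t" "t < 2 * \<alpha>" "\<tau> = cis (- \<alpha>) * cis t"
    using \<tau> unfolding open_arc_def plus minus by auto
  then have \<tau>': "\<tau> = cis (t - \<alpha>)" by (simp add: cis_mult)
  then show "cmod \<tau> = 1" by simp
  have "cos \<alpha> < cos \<bar>t - \<alpha>\<bar>" using t \<alpha> by (intro cos_monotone_0_pi) auto
  then have "c < Re \<tau>" by (simp add: \<tau>' \<alpha>)
  then have "1 - k\<^sup>2 < Re \<tau> * (1 + k\<^sup>2)" using k1 by (simp add: c_def divide_less_eq)
  then have "1 - Re \<tau> < k\<^sup>2 * (1 + Re \<tau>)" by (simp add: algebra_simps)
  then have "(1 - \<sigma>\<^sup>2)\<^sup>2 * (1 - Re \<tau>) < (1 - \<sigma>\<^sup>2)\<^sup>2 * (k\<^sup>2 * (1 + Re \<tau>))"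
    using q by (intro mult_strict_left_mono) auto
  also have "\<dots> = ((1 - \<sigma>\<^sup>2) * k)\<^sup>2 * (1 + Re \<tau>)" by (simp add: power_mult_distrib)
  also have "(1 - \<sigma>\<^sup>2) * k = 2 * \<sigma>" using q by (simp add: k_def)
  finally show "(1 - \<sigma>\<^sup>2)\<^sup>2 * (1 - Re \<tau>) < 4 * \<sigma>\<^sup>2 * (1 + Re \<tau>)" by (simp add: power_mult_distrib)
qed

section \<open>The balanced geodesics\<close>

lemma b_map_defect:
  "(cmod (1 - of_real \<sigma> * z))\<^sup>2 - (cmod (z - of_real \<sigma>))\<^sup>2 = (1 - \<sigma>\<^sup>2) * (1 - (cmod z)\<^sup>2)"
  by (simp add: cmod_power2) (simp add: power2_eq_square algebra_simps)

lemma b_map_denominator: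
  assumes "0 < \<sigma>" "\<sigma> < 1" "cmod z \<le> 1"
  shows "1 - of_real \<sigma> * z \<noteq> 0"
proof
  assume "1 - of_real \<sigma> * z = 0"
  then have "cmod (of_real \<sigma> * z) = 1" by (metis eq_iff_diff_eq_0 norm_one)
  then have "\<sigma> * cmod z = 1" using assms(1) by (simp add: norm_mult)
  moreover have "\<sigma> * cmod z \<le> \<sigma> * 1" using assms by (intro mult_left_mono) auto
  ultimately show False using assms(2) by simp
qed

lemma b_map_norm:
  assumes \<sigma>: "0 < \<sigma>" "\<sigma> < 1" and z: "cmod z \<le> 1"
  shows "cmod (b_map \<sigma> z) \<le> 1" and "cmod z < 1 \<Longrightarrow> cmod (b_map \<sigma> z) < 1"
proof -
  have d: "0 < cmod (1 - of_real \<sigma> * z)" using b_map_denominator[OF assms] by simp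
  have q: "0 < 1 - \<sigma>\<^sup>2" using \<sigma> by (simp add: abs_square_less_1)
  have "0 \<le> (1 - \<sigma>\<^sup>2) * (1 - (cmod z)\<^sup>2)"
    using q z by (intro mult_nonneg_nonneg less_imp_le[OF q]) (simp add: abs_square_le_1)
  then have "(cmod (z - of_real \<sigma>))\<^sup>2 \<le> (cmod (1 - of_real \<sigma> * z))\<^sup>2" using b_map_defect[of \<sigma> z] by linarith
  then have "cmod (z - of_real \<sigma>) \<le> cmod (1 - of_real \<sigma> * z)" by (rule power2_le_imp_le) simp
  then show "cmod (b_map \<sigma> z) \<le> 1" using d by (simp add: b_map_def norm_divide)
  assume "cmod z < 1"
  then have "0 < (1 - \<sigma>\<^sup>2) * (1 - (cmod z)\<^sup>2)"
    using q by (intro mult_pos_pos) (auto simp: abs_square_less_1)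
  then have "(cmod (z - of_real \<sigma>))\<^sup>2 < (cmod (1 - of_real \<sigma> * z))\<^sup>2" using b_map_defect[of \<sigma> z] by linarith
  then have "cmod (z - of_real \<sigma>) < cmod (1 - of_real \<sigma> * z)" by (rule power2_less_imp_less) simp
  then show "cmod (b_map \<sigma> z) < 1" using d by (simp add: b_map_def norm_divide)
qed

lemma m_map_in_disc:
  assumes "0 < \<sigma>" "\<sigma> < 1" "cmod \<tau> = 1" "z \<in> \<bbbD>"
  shows "m_map \<sigma> \<tau> z \<in> \<bbbD>"
proof -
  have "cmod (b_map \<sigma> z) < 1" using b_map_norm(2)[of \<sigma> z] assms by simp
  then have "cmod (r_map \<tau> (b_map \<sigma> z)) < 1" using assms(3) by (simp add: r_map_def norm_mult)
  then show ?thesis using b_map_norm(2)[of \<sigma> "r_map \<tau> (b_map \<sigma> z)"] assms by (simp add: m_map_def)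
qed

lemma m_map_at_base:
  assumes "0 < \<sigma>" "\<sigma> < 1"
  shows "m_map \<sigma> \<tau> (of_real \<sigma>) = - of_real \<sigma>"
    and "(m_map \<sigma> \<tau> has_field_derivative \<tau>) (at (of_real \<sigma>))"
proof -
  let ?s = "complex_of_real \<sigma>"
  show "m_map \<sigma> \<tau> ?s = - ?s" by (simp add: m_map_def b_map_def r_map_def)
  have q: "1 - ?s * ?s \<noteq> 0" using b_map_denominator[OF assms, of ?s] assms by simp
  have d1: "(b_map \<sigma> has_field_derivative 1 / (1 - ?s * ?s)) (at ?s)"
    unfolding b_map_def[abs_def] using q by (auto intro!: derivative_eq_intros simp: divide_simps)
  have b: "b_map \<sigma> ?s = 0" by (simp add: b_map_def)
  have d2: "(r_map \<tau> has_field_derivative \<tau>) (at (b_map \<sigma> ?s))"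
    unfolding r_map_def[abs_def] by (auto intro!: derivative_eq_intros)
  have d3: "(b_map \<sigma> has_field_derivative 1 - ?s * ?s) (at ((r_map \<tau> \<circ> b_map \<sigma>) ?s))"
    unfolding b_map_def[abs_def] by (auto intro!: derivative_eq_intros simp: r_map_def)
  show "(m_map \<sigma> \<tau> has_field_derivative \<tau>) (at ?s)"
    using DERIV_chain[OF d3 DERIV_chain[OF d2 d1]] q by (simp add: m_map_def o_assoc)
qed

text \<open>The fixed points of \<open>m_map \<sigma> \<tau>\<close> solve a quadratic equation \<open>z\<^sup>2 - 2 \<i> y z - 1 = 0\<close> with real \<open>y\<close>, and the arc
  condition says precisely \<open>|y| < 1\<close>: then both roots \<open>\<plusminus> x + \<i> y\<close> lie on the circle. Written in terms of \<open>y\<close>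
  instead of \<open>\<tau>\<close>, the coefficients of the Moebius map become symmetric, which makes the later identities polynomial.\<close>

lemma m_map_fixed_point_form:
  assumes \<sigma>: "0 < \<sigma>" "\<sigma> < 1" and \<tau>: "cmod \<tau> = 1"
    and arc: "(1 - \<sigma>\<^sup>2)\<^sup>2 * (1 - Re \<tau>) < 4 * \<sigma>\<^sup>2 * (1 + Re \<tau>)"
  obtains x y where "0 < x" "x\<^sup>2 + y\<^sup>2 = 1"
    "\<And>z. cmod z \<le> 1 \<Longrightarrow> Complex (1 + \<sigma>\<^sup>2) (2 * y * \<sigma>) - 2 * of_real \<sigma> * z \<noteq> 0"
    "\<And>z. cmod z \<le> 1 \<Longrightarrow> m_map \<sigma> \<tau> z =
      (Complex (1 + \<sigma>\<^sup>2) (- 2 * y * \<sigma>) * z - 2 * of_real \<sigma>)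
        / (Complex (1 + \<sigma>\<^sup>2) (2 * y * \<sigma>) - 2 * of_real \<sigma> * z)"
proof -
  define q where "q = 1 - \<sigma>\<^sup>2"
  have q: "0 < q" using \<sigma> by (simp add: q_def abs_square_less_1)
  have n: "(Re \<tau>)\<^sup>2 + (Im \<tau>)\<^sup>2 = 1" using \<tau> by (simp add: cmod_power2[symmetric])
  have "Re \<tau> \<le> 1" using complex_Re_le_cmod[of \<tau>] \<tau> by simp
  then have "0 \<le> q\<^sup>2 * (1 - Re \<tau>)" by simp
  then have "0 < 4 * \<sigma>\<^sup>2 * (1 + Re \<tau>)" using arc unfolding q_def by (rule le_less_trans)
  then have R: "0 < 1 + Re \<tau>" using \<sigma> by (simp add: zero_less_mult_iff)
  define y where "y = - (q * Im \<tau>) / (2 * \<sigma> * (1 + Re \<tau>))"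
  have y1: "y\<^sup>2 < 1"
  proof -
    have "(q * Im \<tau>)\<^sup>2 = (q\<^sup>2 * (1 - Re \<tau>)) * (1 + Re \<tau>)"
    proof -
      have "(Im \<tau>)\<^sup>2 = (1 - Re \<tau>) * (1 + Re \<tau>)" using n by (simp add: algebra_simps power2_eq_square)
      then show ?thesis by (simp add: power_mult_distrib)
    qed
    also have "\<dots> < (4 * \<sigma>\<^sup>2 * (1 + Re \<tau>)) * (1 + Re \<tau>)"
      using arc R by (intro mult_strict_right_mono) (auto simp: q_def)
    also have "\<dots> = (2 * \<sigma> * (1 + Re \<tau>))\<^sup>2" by (simp add: power2_eq_square)
    finally show ?thesis
      using \<sigma> R by (simp add: y_def power_divide divide_less_eq)
  qed
  define x where "x = sqrt (1 - y\<^sup>2)"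
  have x: "0 < x" "x\<^sup>2 + y\<^sup>2 = 1" using y1 by (simp_all add: x_def)
  let ?s = "complex_of_real \<sigma>"
  \<comment> \<open>Scaling numerator and denominator by \<open>\<kappa>\<close> removes \<open>\<tau>\<close>, since \<open>\<tau> = cnj \<kappa> / \<kappa>\<close>.\<close>
  define \<kappa> where "\<kappa> = Complex q (2 * y * \<sigma>)"
  have y2: "2 * y * \<sigma> * (1 + Re \<tau>) = - q * Im \<tau>" using \<sigma> R by (simp add: y_def)
  have \<kappa>0: "\<kappa> \<noteq> 0" using q by (auto simp: \<kappa>_def complex_eq_iff)
  have \<kappa>\<tau>: "\<kappa> * \<tau> = cnj \<kappa>"
  proof -
    have "of_real (1 + Re \<tau>) * \<kappa> = of_real q * (1 + cnj \<tau>)"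
      using y2 by (simp add: complex_eq_iff \<kappa>_def algebra_simps)
    then have "of_real (1 + Re \<tau>) * (\<kappa> * \<tau>) = of_real q * (1 + cnj \<tau>) * \<tau>"
      by (simp only: mult.assoc[symmetric])
    also have "\<dots> = of_real q * (\<tau> + \<tau> * cnj \<tau>)"
      by (simp add: algebra_simps)
    also have "\<tau> * cnj \<tau> = 1" using \<tau> by (simp add: complex_norm_square[symmetric])
    also have "of_real q * (\<tau> + 1) = of_real (1 + Re \<tau>) * cnj \<kappa>"
      using y2 by (simp add: complex_eq_iff \<kappa>_def algebra_simps)
    finally show ?thesis using R by (simp del: of_real_add)
  qed
  define A where "A = Complex (1 + \<sigma>\<^sup>2) (- 2 * y * \<sigma>)"
  define C where "C = Complex (1 + \<sigma>\<^sup>2) (2 * y * \<sigma>)"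
  have e1: "\<kappa> * (\<tau> + ?s\<^sup>2) = of_real q * A"
    unfolding distrib_left \<kappa>\<tau> by (simp add: complex_eq_iff \<kappa>_def A_def q_def algebra_simps power2_eq_square)
  have e2: "\<kappa> * (\<tau> + 1) = 2 * of_real q"
    unfolding distrib_left \<kappa>\<tau> by (simp add: complex_eq_iff \<kappa>_def)
  have e3: "\<kappa> * (1 + ?s\<^sup>2 * \<tau>) = of_real q * C"
  proof -
    have "\<kappa> * (1 + ?s\<^sup>2 * \<tau>) = \<kappa> + ?s\<^sup>2 * (\<kappa> * \<tau>)" by (simp add: algebra_simps)
    then show ?thesis
      unfolding \<kappa>\<tau> by (simp add: complex_eq_iff \<kappa>_def C_def q_def algebra_simps power2_eq_square)
  qed
  have main: "C - 2 * ?s * z \<noteq> 0 \<and> m_map \<sigma> \<tau> z = (A * z - 2 * ?s) / (C - 2 * ?s * z)" if z: "cmod z \<le> 1" for z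
  proof -
    have d1: "1 - ?s * z \<noteq> 0" by (rule b_map_denominator[OF \<sigma> z])
    have "cmod (\<tau> * b_map \<sigma> z) \<le> 1" using b_map_norm(1)[OF \<sigma> z] \<tau> by (simp add: norm_mult)
    then have d2: "1 - ?s * (\<tau> * b_map \<sigma> z) \<noteq> 0" by (rule b_map_denominator[OF \<sigma>])
    have den: "\<kappa> * ((1 - ?s * (\<tau> * b_map \<sigma> z)) * (1 - ?s * z)) = of_real q * (C - 2 * ?s * z)"
    proof -
      have "(1 - ?s * (\<tau> * b_map \<sigma> z)) * (1 - ?s * z) = (1 + ?s\<^sup>2 * \<tau>) - ?s * z * (\<tau> + 1)"
        using d1 by (simp add: b_map_def field_simps power2_eq_square)
      then have "\<kappa> * ((1 - ?s * (\<tau> * b_map \<sigma> z)) * (1 - ?s * z))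
        = \<kappa> * ((1 + ?s\<^sup>2 * \<tau>) - ?s * z * (\<tau> + 1))" by (simp only:)
      also have "\<dots> = \<kappa> * (1 + ?s\<^sup>2 * \<tau>) - ?s * z * (\<kappa> * (\<tau> + 1))" by (simp add: algebra_simps)
      also have "\<dots> = of_real q * (C - 2 * ?s * z)" unfolding e2 e3 by (simp add: algebra_simps)
      finally show ?thesis .
    qed
    have num: "\<kappa> * ((\<tau> * b_map \<sigma> z - ?s) * (1 - ?s * z)) = of_real q * (A * z - 2 * ?s)"
    proof -
      have "(\<tau> * b_map \<sigma> z - ?s) * (1 - ?s * z) = (\<tau> + ?s\<^sup>2) * z - ?s * (\<tau> + 1)"
        using d1 by (simp add: b_map_def field_simps power2_eq_square)
      then have "\<kappa> * ((\<tau> * b_map \<sigma> z - ?s) * (1 - ?s * z))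
        = \<kappa> * ((\<tau> + ?s\<^sup>2) * z - ?s * (\<tau> + 1))" by (simp only:)
      also have "\<dots> = \<kappa> * (\<tau> + ?s\<^sup>2) * z - ?s * (\<kappa> * (\<tau> + 1))" by (simp add: algebra_simps)
      also have "\<dots> = of_real q * (A * z - 2 * ?s)" unfolding e1 e2 by (simp add: algebra_simps)
      finally show ?thesis .
    qed
    have "\<kappa> * ((1 - ?s * (\<tau> * b_map \<sigma> z)) * (1 - ?s * z)) \<noteq> 0" using \<kappa>0 d1 d2 by simp
    then have nz: "C - 2 * ?s * z \<noteq> 0" unfolding den by auto
    have "m_map \<sigma> \<tau> z = (\<tau> * b_map \<sigma> z - ?s) / (1 - ?s * (\<tau> * b_map \<sigma> z))"
      by (simp add: m_map_def r_map_def b_map_def[of \<sigma> "\<tau> * b_map \<sigma> z"])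
    also have "\<dots> = (\<kappa> * ((\<tau> * b_map \<sigma> z - ?s) * (1 - ?s * z))) / (\<kappa> * ((1 - ?s * (\<tau> * b_map \<sigma> z)) * (1 - ?s * z)))"
      using \<kappa>0 d1 by simp
    also have "\<dots> = (A * z - 2 * ?s) / (C - 2 * ?s * z)"
      unfolding num den using q by simp
    finally show ?thesis using nz by blast
  qed
  show ?thesis by (rule that[of x y]) (use x main in \<open>auto simp: A_def C_def\<close>)
qed

lemma cayley_disc: "cmod u < 1 \<Longrightarrow> 0 < Re ((1 + u) / (1 - u))"
proof -
  assume u: "cmod u < 1"
  then have "1 - u \<noteq> 0" by auto
  then have p: "0 < (cmod (1 - u))\<^sup>2" by simp
  have "Re ((1 + u) / (1 - u)) = (1 - (cmod u)\<^sup>2) / (cmod (1 - u))\<^sup>2"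
    unfolding Re_divide cmod_power2 by (simp add: power2_eq_square algebra_simps)
  then show ?thesis using p u by (simp add: abs_square_less_1)
qed

lemma cayley_half_plane: "0 < Re H \<Longrightarrow> H + 1 \<noteq> 0 \<and> cmod ((H - 1) / (H + 1)) < 1"
proof -
  assume H: "0 < Re H"
  then have nz: "H + 1 \<noteq> 0" by (auto simp: complex_eq_iff)
  have "(cmod (H - 1))\<^sup>2 < (cmod (H + 1))\<^sup>2"
    using H by (simp add: cmod_power2) (simp add: power2_eq_square algebra_simps)
  then have "cmod (H - 1) < cmod (H + 1)" by (rule power2_less_imp_less) simp
  then show ?thesis using nz by (simp add: norm_divide)
qed

text \<open>If the Cayley transform at a boundary point turns \<open>m\<close> into an affine map, then the sum \<open>A\<close> of the transforms of \<open>z\<close> and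
  \<open>m z\<close>, a holomorphic function of \<open>h_map m z\<close> with values in the right half plane, determines the transform of \<open>z\<close> by an affine formula.\<close>

lemma geodesic_map_of_affine_cayley:
  fixes m :: "complex \<Rightarrow> complex"
  assumes m: "m holomorphic_on \<bbbD>" "m ` \<bbbD> \<subseteq> \<bbbD>" and \<omega>: "cmod \<omega> = 1" and a: "0 < a"
    and aff: "\<And>z. z \<in> \<bbbD> \<Longrightarrow> (1 + \<omega> * m z) / (1 - \<omega> * m z) = of_real a * ((1 + \<omega> * z) / (1 - \<omega> * z)) + \<i> * of_real \<beta>"
  shows "geodesic_map (h_map m)"
proof -
  define A where "A x = 2 * (1 - \<omega>\<^sup>2 * x $ 2) / (1 - \<omega> * x $ 1 + \<omega>\<^sup>2 * x $ 2)" for x :: "complex^2"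
  define H where "H x = (A x - \<i> * of_real \<beta>) / of_real (1 + a)" for x
  define g where "g x = cnj \<omega> * ((H x - 1) / (H x + 1))" for x
  have a1: "1 + a \<noteq> 0" "complex_of_real (1 + a) \<noteq> 0" using a by (auto simp del: of_real_add)
  have \<omega>u: "cmod (\<omega> * u) < 1" "1 - \<omega> * u \<noteq> 0" if "u \<in> \<bbbD>" for u
  proof -
    show "cmod (\<omega> * u) < 1" using that \<omega> by (simp add: norm_mult)
    then show "1 - \<omega> * u \<noteq> 0" by auto
  qed
  have den: "1 - \<omega> * (z + w) + \<omega>\<^sup>2 * (z * w) = (1 - \<omega> * z) * (1 - \<omega> * w)" for z w
    by (simp add: algebra_simps power2_eq_square)
  have A: "A (symmetrize z w) = (1 + \<omega> * z) / (1 - \<omega> * z) + (1 + \<omega> * w) / (1 - \<omega> * w)"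
    if zw: "z \<in> \<bbbD>" "w \<in> \<bbbD>" for z w
    using \<omega>u(2)[OF zw(1)] \<omega>u(2)[OF zw(2)] unfolding A_def symmetrize_nth den
    by (simp add: add_frac_eq) (simp add: algebra_simps power2_eq_square)
  have A_pos: "0 < Re (A x)" if "x \<in> sym_bidisc" for x
    using that
  proof (rule sym_bidisc_cases)
    fix z w assume zw: "z \<in> \<bbbD>" "w \<in> \<bbbD>" "x = symmetrize z w"
    show ?thesis
      unfolding zw(3) A[OF zw(1,2)] using cayley_disc[OF \<omega>u(1)[OF zw(1)]] cayley_disc[OF \<omega>u(1)[OF zw(2)]] by simp
  qed
  have H_pos: "0 < Re (H x)" if "x \<in> sym_bidisc" for x
    using A_pos[OF that] a unfolding H_def by (simp del: of_real_add add: Re_divide_of_real)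
  have H_nz: "H x + 1 \<noteq> 0" if "x \<in> sym_bidisc" for x
    using cayley_half_plane[OF H_pos[OF that]] by blast
  have D_nz: "1 - \<omega> * x $ 1 + \<omega>\<^sup>2 * x $ 2 \<noteq> 0" if "x \<in> sym_bidisc" for x :: "complex^2"
    using that
  proof (rule sym_bidisc_cases)
    fix z w assume zw: "z \<in> \<bbbD>" "w \<in> \<bbbD>" "x = symmetrize z w"
    show ?thesis unfolding zw(3) symmetrize_nth den using \<omega>u(2)[OF zw(1)] \<omega>u(2)[OF zw(2)] by simp
  qed
  have "holomorphic_fun_on A sym_bidisc"
    unfolding A_def by (intro hol_fun_intros D_nz)
  then have "holomorphic_fun_on H sym_bidisc"
    unfolding H_def by (intro hol_fun_intros a1)
  then have g_hol: "holomorphic_fun_on g sym_bidisc"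
    unfolding g_def by (intro hol_fun_intros H_nz)
  have g_in: "g ` sym_bidisc \<subseteq> \<bbbD>"
    using cayley_half_plane[OF H_pos] \<omega>
    by (auto simp: g_def norm_mult simp del: times_divide_eq_right)
  have h_sym: "h_map m z = symmetrize z (m z)" for z by (simp add: h_map_def symmetrize_def)
  have g_inv: "g (h_map m z) = z" if z: "z \<in> \<bbbD>" for z
  proof -
    let ?c = "(1 + \<omega> * z) / (1 - \<omega> * z)"
    have mz: "m z \<in> \<bbbD>" using m(2) z by blast
    have "A (h_map m z) - \<i> * of_real \<beta> = of_real (1 + a) * ?c"
      unfolding h_sym A[OF z mz] aff[OF z] of_real_add of_real_1
      by (simp only: distrib_right mult_1 add.assoc[symmetric] add_diff_cancel_right')
    then have "H (h_map m z) = ?c" using a1 by (simp add: H_def del: of_real_add)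
    moreover have "(?c - 1) / (?c + 1) = \<omega> * z"
      using \<omega>u(2)[OF z] by (simp add: divide_simps)
    moreover have "cnj \<omega> * \<omega> = 1" using \<omega> by (metis complex_norm_square mult.commute of_real_1 one_power2)
    ultimately show ?thesis by (simp add: g_def mult.assoc[symmetric])
  qed
  have "(\<lambda>z. h_map m z $ i) holomorphic_on \<bbbD>" for i
  proof -
    have "i = 1 \<or> i = 2" by (rule exhaust_2)
    then show ?thesis unfolding h_sym by (auto intro!: holomorphic_intros m(1))
  qed
  moreover have "h_map m ` \<bbbD> \<subseteq> sym_bidisc"
    using m(2) by (auto simp: h_sym symmetrize_in_sym_bidisc_iff image_subset_iff)
  ultimately show ?thesis
    unfolding geodesic_map_def using g_hol g_in g_inv by blast
qed

lemma closure_image_disc: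
  fixes f :: "complex \<Rightarrow> complex^2"
  assumes "continuous_on (cball 0 1) f"
  shows "closure (f ` \<bbbD>) = f ` cball 0 1"
proof
  have "closed (f ` cball 0 1)" by (intro compact_imp_closed compact_continuous_image assms) simp
  then show "closure (f ` \<bbbD>) \<subseteq> f ` cball 0 1" by (intro closure_minimal) auto
  show "f ` cball 0 1 \<subseteq> closure (f ` \<bbbD>)"
    using image_closure_subset[of "\<bbbD>" f "closure (f ` \<bbbD>)"] assms
    by (simp add: closure_subset)
qed

text \<open>A point of the closure of \<open>B_set\<close> lies in the closure of the royal variety when its roots \<open>z\<close> and \<open>m z\<close> coincide,
  so the intersection corresponds to the fixed points of \<open>m\<close> in the closed disc.\<close>

lemma B_set_purely_balanced:
  assumes \<sigma>: "0 < \<sigma>" "\<sigma> < 1" and \<tau>: "cmod \<tau> = 1"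
    and arc: "(1 - \<sigma>\<^sup>2)\<^sup>2 * (1 - Re \<tau>) < 4 * \<sigma>\<^sup>2 * (1 + Re \<tau>)"
  shows "geodesic_map (h_map (m_map \<sigma> \<tau>))" and "purely_balanced (B_set (m_map \<sigma> \<tau>))"
proof -
  let ?m = "m_map \<sigma> \<tau>" and ?s = "complex_of_real \<sigma>"
  obtain x y where x: "0 < x" and xy: "x\<^sup>2 + y\<^sup>2 = 1"
    and nz: "\<And>z. cmod z \<le> 1 \<Longrightarrow> Complex (1 + \<sigma>\<^sup>2) (2 * y * \<sigma>) - 2 * ?s * z \<noteq> 0"
    and m: "\<And>z. cmod z \<le> 1 \<Longrightarrow> ?m z = (Complex (1 + \<sigma>\<^sup>2) (- 2 * y * \<sigma>) * z - 2 * ?s)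
        / (Complex (1 + \<sigma>\<^sup>2) (2 * y * \<sigma>) - 2 * ?s * z)"
    using m_map_fixed_point_form[OF assms] by metis
  define A where "A = Complex (1 + \<sigma>\<^sup>2) (- 2 * y * \<sigma>)"
  define C where "C = Complex (1 + \<sigma>\<^sup>2) (2 * y * \<sigma>)"
  define \<eta> where "\<eta> = Complex x y"
  note nz = nz[folded C_def] and m = m[folded A_def C_def]
  have \<eta>1: "cmod \<eta> = 1" using xy by (simp add: \<eta>_def complex_norm)
  have \<eta>c: "\<eta> * cnj \<eta> = 1" using \<eta>1 by (metis complex_norm_square of_real_1 one_power2)
  have m_hol: "?m holomorphic_on \<bbbD>"
  proof -
    have "(\<lambda>z. (A * z - 2 * ?s) / (C - 2 * ?s * z)) holomorphic_on \<bbbD>"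
      by (intro holomorphic_intros) (use nz in auto)
    then show ?thesis by (rule holomorphic_transform) (use m in auto)
  qed
  have m_in: "?m ` \<bbbD> \<subseteq> \<bbbD>" using m_map_in_disc[OF \<sigma> \<tau>] by blast
  have m_cont: "continuous_on (cball 0 1) ?m"
  proof -
    have "continuous_on (cball 0 1) (\<lambda>z. (A * z - 2 * ?s) / (C - 2 * ?s * z))"
      by (intro continuous_intros) (use nz in auto)
    then show ?thesis by (rule continuous_on_eq) (use m in auto)
  qed
  have "x\<^sup>2 \<le> 1\<^sup>2" unfolding one_power2 using xy zero_le_power2[of y] by linarith
  then have x1: "x \<le> 1" by (rule power2_le_imp_le) simp
  \<comment> \<open>\<open>Q / P\<close> is the multiplier of the affine map that the Cayley transform makes of \<open>m\<close>.\<close>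
  define P where "P = 1 + \<sigma>\<^sup>2 + 2 * \<sigma> * x"
  define Q where "Q = 1 + \<sigma>\<^sup>2 - 2 * \<sigma> * x"
  have P: "0 < P" using \<sigma> x by (simp add: P_def add_pos_nonneg)
  have Q: "0 < Q"
  proof -
    have "\<sigma> * x \<le> \<sigma> * 1" using \<sigma> x1 by (intro mult_left_mono) auto
    moreover have "0 < (1 - \<sigma>)\<^sup>2" using \<sigma> by simp
    ultimately show ?thesis by (simp add: Q_def power2_eq_square algebra_simps)
  qed
  show geo: "geodesic_map (h_map ?m)"
  proof (rule geodesic_map_of_affine_cayley[OF m_hol m_in, of "cnj \<eta>" "Q / P" "4 * \<sigma> * y / P"])
    show "cmod (cnj \<eta>) = 1" using \<eta>1 by simp
    show "0 < Q / P" using P Q by simp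
    fix z assume z: "z \<in> \<bbbD>"
    then have z1: "cmod z \<le> 1" by simp
    let ?\<omega> = "cnj \<eta>" and ?d = "C - 2 * ?s * z"
    have "cmod (?\<omega> * z) < 1" using z \<eta>1 by (simp add: norm_mult)
    then have nz1: "1 - ?\<omega> * z \<noteq> 0" by auto
    have c1: "C + 2 * ?s * ?\<omega> = of_real P"
      by (simp add: complex_eq_iff C_def \<eta>_def P_def)
    have c2: "A + 2 * ?s * \<eta> = of_real P"
      by (simp add: complex_eq_iff A_def \<eta>_def P_def)
    have c3: "C - 2 * ?s * ?\<omega> = of_real Q + \<i> * of_real (4 * \<sigma> * y)"
      by (simp add: complex_eq_iff C_def \<eta>_def Q_def)
    have c4: "A - 2 * ?s * \<eta> = of_real Q - \<i> * of_real (4 * \<sigma> * y)"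
      by (simp add: complex_eq_iff A_def \<eta>_def Q_def)
    have \<omega>A: "?\<omega> * A * z + 2 * ?s * z = ?\<omega> * (A + 2 * ?s * \<eta>) * z" "?\<omega> * A * z - 2 * ?s * z = ?\<omega> * (A - 2 * ?s * \<eta>) * z"
      using \<eta>c by (simp_all add: algebra_simps)
    have mz: "?m z = (A * z - 2 * ?s) / ?d" by (rule m[OF z1])
    have l: "1 - ?\<omega> * ?m z = of_real P * (1 - ?\<omega> * z) / ?d"
    proof -
      have "?d - ?\<omega> * (A * z - 2 * ?s) = (C + 2 * ?s * ?\<omega>) - (?\<omega> * A * z + 2 * ?s * z)"
        by (simp add: algebra_simps)
      also have "\<dots> = of_real P * (1 - ?\<omega> * z)"
        unfolding c1 \<omega>A c2 by (simp add: algebra_simps)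
      finally show ?thesis unfolding mz using nz[OF z1] by (simp add: divide_simps)
    qed
    have u: "1 + ?\<omega> * ?m z = (of_real Q * (1 + ?\<omega> * z) + \<i> * of_real (4 * \<sigma> * y) * (1 - ?\<omega> * z)) / ?d"
    proof -
      have "?d + ?\<omega> * (A * z - 2 * ?s) = (C - 2 * ?s * ?\<omega>) + (?\<omega> * A * z - 2 * ?s * z)"
        by (simp add: algebra_simps)
      also have "\<dots> = of_real Q * (1 + ?\<omega> * z) + \<i> * of_real (4 * \<sigma> * y) * (1 - ?\<omega> * z)"
        unfolding c3 \<omega>A c4 by (simp add: algebra_simps)
      finally show ?thesis unfolding mz using nz[OF z1] by (simp add: divide_simps)
    qed
    have P0: "complex_of_real P \<noteq> 0" using P by simp
    have "(1 + ?\<omega> * ?m z) / (1 - ?\<omega> * ?m z)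
      = (of_real Q * (1 + ?\<omega> * z) + \<i> * of_real (4 * \<sigma> * y) * (1 - ?\<omega> * z)) / (of_real P * (1 - ?\<omega> * z))"
      unfolding l u using nz[OF z1] by simp
    also have "\<dots> = of_real (Q / P) * ((1 + ?\<omega> * z) / (1 - ?\<omega> * z)) + \<i> * of_real (4 * \<sigma> * y / P)"
    proof -
      have "(q * u + b * n) / (p * n) = q / p * (u / n) + b / p" if "p \<noteq> 0" "n \<noteq> 0" for q u b n p :: complex
        using that by (simp add: field_simps)
      from this[OF P0 nz1] show ?thesis unfolding of_real_divide times_divide_eq_right .
    qed
    finally show "(1 + ?\<omega> * ?m z) / (1 - ?\<omega> * ?m z)
      = of_real (Q / P) * ((1 + ?\<omega> * z) / (1 - ?\<omega> * z)) + \<i> * of_real (4 * \<sigma> * y / P)" .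
  qed
  have fixed: "?m z = z \<longleftrightarrow> z = \<eta> \<or> z = - cnj \<eta>" if z: "cmod z \<le> 1" for z
  proof -
    have "?m z = z \<longleftrightarrow> A * z - 2 * ?s = z * (C - 2 * ?s * z)"
      unfolding m[OF z] using nz[OF z] by (simp add: divide_eq_eq)
    also have "\<dots> \<longleftrightarrow> 2 * ?s * ((z - \<eta>) * (z + cnj \<eta>)) = 0"
    proof -
      have "A = C - 2 * ?s * (\<eta> - cnj \<eta>)"
        by (simp add: complex_eq_iff A_def C_def \<eta>_def)
      then have "A * z = (C - 2 * ?s * (\<eta> - cnj \<eta>)) * z" by (simp only:)
      then have "A * z - 2 * ?s - z * (C - 2 * ?s * z)
        = 2 * ?s * (z\<^sup>2 - (\<eta> - cnj \<eta>) * z - \<eta> * cnj \<eta>)"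
        unfolding \<eta>c by (simp add: algebra_simps power2_eq_square)
      also have "\<dots> = 2 * ?s * ((z - \<eta>) * (z + cnj \<eta>))"
        by (simp add: algebra_simps power2_eq_square)
      finally show ?thesis by (metis right_minus_eq)
    qed
    also have "\<dots> \<longleftrightarrow> z = \<eta> \<or> z = - cnj \<eta>" using \<sigma> by (simp add: eq_neg_iff_add_eq_0)
    finally show ?thesis .
  qed
  have hs: "h_map ?m = (\<lambda>z. symmetrize z (?m z))" by (simp add: h_map_def symmetrize_def fun_eq_iff)
  have B: "closure (B_set ?m) = (\<lambda>z. symmetrize z (?m z)) ` cball 0 1"
    unfolding B_set_def hs by (intro closure_image_disc continuous_on_symmetrize continuous_on_id m_cont)
  have royal: "royal = (\<lambda>z. symmetrize z z) ` \<bbbD>"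
    unfolding royal_def symmetrize_diagonal[symmetric] by auto
  have R: "closure royal = (\<lambda>z. symmetrize z z) ` cball 0 1"
    unfolding royal by (intro closure_image_disc continuous_on_symmetrize continuous_on_id)
  have "closure (B_set ?m) \<inter> closure royal = (\<lambda>z. symmetrize z z) ` {z. cmod z \<le> 1 \<and> ?m z = z}"
    unfolding B R
  proof
    show "(\<lambda>z. symmetrize z (?m z)) ` cball 0 1 \<inter> (\<lambda>z. symmetrize z z) ` cball 0 1
        \<subseteq> (\<lambda>z. symmetrize z z) ` {z. cmod z \<le> 1 \<and> ?m z = z}"
      by (auto simp: symmetrize_eq_iff)
    show "(\<lambda>z. symmetrize z z) ` {z. cmod z \<le> 1 \<and> ?m z = z}
        \<subseteq> (\<lambda>z. symmetrize z (?m z)) ` cball 0 1 \<inter> (\<lambda>z. symmetrize z z) ` cball 0 1"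
    proof
      fix p assume "p \<in> (\<lambda>z. symmetrize z z) ` {z. cmod z \<le> 1 \<and> ?m z = z}"
      then obtain z where "cmod z \<le> 1" "?m z = z" "p = symmetrize z z" by blast
      then show "p \<in> (\<lambda>z. symmetrize z (?m z)) ` cball 0 1 \<inter> (\<lambda>z. symmetrize z z) ` cball 0 1"
        by (intro IntI image_eqI[of _ _ z]) simp_all
    qed
  qed
  also have "{z. cmod z \<le> 1 \<and> ?m z = z} = {\<eta>, - cnj \<eta>}" using fixed \<eta>1 by auto
  finally have I: "closure (B_set ?m) \<inter> closure royal = {symmetrize \<eta> \<eta>, symmetrize (- cnj \<eta>) (- cnj \<eta>)}"
    by simp
  have "\<eta> \<noteq> - cnj \<eta>" using x by (auto simp: complex_eq_iff \<eta>_def)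
  then have "card (closure (B_set ?m) \<inter> closure royal) = 2"
    unfolding I by (simp add: symmetrize_eq_iff)
  moreover have "closure (B_set ?m) \<inter> closure royal \<subseteq> {vector [2 * z, z\<^sup>2] | z. z \<in> \<bbbT>}"
  proof -
    have "\<eta> \<in> \<bbbT>" "- cnj \<eta> \<in> \<bbbT>" using \<eta>1 by simp_all
    then show ?thesis unfolding I symmetrize_diagonal by blast
  qed
  moreover have "geodesic (B_set ?m)" unfolding geodesic_def B_set_def using geo by blast
  ultimately show "purely_balanced (B_set ?m)" by (simp add: purely_balanced_def)
qed

theorem corollary5p10:
  fixes \<sigma> :: real and \<tau> :: complex
  assumes "0 < \<sigma>" and "\<sigma> < 1"
    and "\<tau> \<in> open_arc (tau_minus \<sigma>) (tau_plus \<sigma>)"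
  shows "purely_balanced (B_set (m_map \<sigma> \<tau>)) \<and>
         base_point \<sigma> \<in> B_set (m_map \<sigma> \<tau>) \<and>
         (geodesic_tangent (B_set (m_map \<sigma> \<tau>)) (base_point \<sigma>) = sharp (base_point \<sigma>)
            \<longleftrightarrow> \<tau> = 1)"
proof (intro conjI)
  let ?m = "m_map \<sigma> \<tau>" and ?s = "complex_of_real \<sigma>"
  note arc = open_arc_tau[OF assms]
  note B = B_set_purely_balanced[OF assms(1,2) arc]
  show "purely_balanced (B_set ?m)" by (rule B(2))
  have s: "?s \<in> \<bbbD>" using assms by simp
  have base: "h_map ?m ?s = base_point \<sigma>"
    by (simp add: h_map_def m_map_at_base(1)[OF assms(1,2)] base_point_def power2_eq_square)
  then show "base_point \<sigma> \<in> B_set ?m" unfolding B_set_def using s by (metis imageI)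
  let ?v = "vector [1 + \<tau>, ?s * (\<tau> - 1)] :: complex^2" and ?e = "vector [1, 0] :: complex^2"
  have "has_curve_derivative (h_map ?m) ?v ?s"
    unfolding has_curve_derivative_def forall_2 h_map_def
    by (auto intro!: derivative_eq_intros m_map_at_base(2)[OF assms(1,2)]
        simp: m_map_at_base(1)[OF assms(1,2)] algebra_simps)
  then have "geodesic_tangent (B_set ?m) (base_point \<sigma>) = vec.span {?v}"
    using geodesic_tangent_eq[OF B(1) s] unfolding base B_set_def[symmetric]
    by (simp add: has_curve_derivative_imp_curve_deriv)
  moreover have "vec.span {?v} = vec.span {?e} \<longleftrightarrow> \<tau> = 1"
  proof
    assume "vec.span {?v} = vec.span {?e}"
    then have "?v \<in> vec.span {?e}" using vec.span_base[of ?v "{?v}"] by simp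
    then obtain c where "?v = c *s ?e" unfolding vec.span_singleton by auto
    then have "?s * (\<tau> - 1) = 0" by (simp add: vec2_eq_iff)
    then show "\<tau> = 1" using assms by simp
  next
    assume "\<tau> = 1"
    then have v: "?v = 2 *s ?e" by (simp add: vec2_eq_iff)
    then have "?e = (1/2) *s ?v" by (simp add: vec2_eq_iff)
    then have "?e \<in> vec.span {?v}" "?v \<in> vec.span {?e}"
      using v by (metis vec.span_base vec.span_scale singletonI)+
    then show "vec.span {?v} = vec.span {?e}"
      by (intro equalityI vec.span_minimal vec.subspace_span) auto
  qed
  ultimately show "geodesic_tangent (B_set ?m) (base_point \<sigma>) = sharp (base_point \<sigma>) \<longleftrightarrow> \<tau> = 1"
    by (simp add: sharp_base_point[OF assms(1,2)])
qed

end
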